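(* Let $q=1/p$ with $p\in\mathbb{N}\setminus\{0,1\}$ (that is, $p\geq 2$ an integer), let $\zeta_q(2)=\sum_{k=1}^\infty \frac{kq^k}{1-q^k}$, and let $\rho=\frac{10\pi^2}{5\pi^2-24}$. Then $\zeta_q(2)$ is irrational, and the inequality \[\left|\zeta_q(2)-\frac{a}{b}\right|\leq |b|^{-\rho}\] has at most finitely many integer solutions $(a,b)$.
   Context: Here $\mathbb{N}$ denotes the natural numbers including $0$. The number $\zeta_q(2)$ is a $q$-analogue of $\zeta(2)=\sum_{k=1}^\infty 1/k^2$, in the sense that $\lim_{q\to 1^-}(1-q)^2\zeta_q(2)=\zeta(2)$. Solutions $(a,b)$ are pairs of integers for which the fraction $a/b$ makes sense, i.e. $b\neq 0$. *)

theory Defs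
  imports Complex_Main
begin

(* The k-th summand below is the summand of index k + 1 in the usual sum over k >= 1. *)
definition zeta_q2 :: "real \<Rightarrow> real" where
  "zeta_q2 q = (\<Sum>k. real (Suc k) * q ^ Suc k / (1 - q ^ Suc k))"

lemma summable_zeta_q2:
  fixes q :: real
  assumes "0 < q" "q < 1"
  shows "summable (\<lambda>k. real (Suc k) * q ^ Suc k / (1 - q ^ Suc k))"
proof (rule summable_comparison_test')
  have "summable (\<lambda>k. real (Suc k) * q ^ k)"
    using geometric_deriv_sums[of q] assms by (auto simp: sums_iff)
  then show "summable (\<lambda>k. (q / (1 - q)) * (real (Suc k) * q ^ k))"
    by (rule summable_mult)
next
  fix k :: nat
  have le: "q ^ Suc k \<le> q"
    using assms power_le_one[of q k] by (simp add: mult_left_le)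
  have "real (Suc k) * q ^ Suc k / (1 - q ^ Suc k) \<le> real (Suc k) * q ^ Suc k / (1 - q)"
    using le assms by (intro divide_left_mono mult_pos_pos) (auto simp del: power_Suc)
  moreover have "0 \<le> real (Suc k) * q ^ Suc k / (1 - q ^ Suc k)"
    using le assms by (intro divide_nonneg_nonneg) (auto simp del: power_Suc)
  ultimately show "norm (real (Suc k) * q ^ Suc k / (1 - q ^ Suc k))
      \<le> (q / (1 - q)) * (real (Suc k) * q ^ k)"
    unfolding real_norm_def by (subst abs_of_nonneg) (simp_all add: ac_simps)
qed

end

theory Submission
  imports Defs "HOL-Analysis.Analysis" "HOL-Number_Theory.Number_Theory" "HOL-Real_Asymp.Real_Asymp"
begin

text \<open>
  Since \<open>\<zeta>\<^sub>q(2) = \<Sum> p\<^sup>l / (p\<^sup>l - 1)\<^sup>2\<close>, a rational function with poles at \<open>x = 1, 1/p, 1/p\<^sup>2, \<dots>\<close> of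
  order at most two, summed over \<open>x = p, p\<^sup>2, \<dots>\<close>, is a linear form in \<open>1\<close> and \<open>\<zeta>\<^sub>q(2)\<close> as soon as the
  contributions of the simple poles telescope. The classical choice, with double poles
  \<open>p ^ - j\<close> for \<open>0 \<le> j \<le> n\<close> and zeros \<open>p, \<dots>, p ^ n\<close>, has the exponent \<open>\<rho>\<close> of the theorem as
  its limit. It proves finiteness only for exponents larger than \<open>\<rho>\<close>, because consecutive
  approximations differ by factors \<open>p ^ O(n)\<close>. Therefore a slightly better family
  is used: with \<open>n = 16 N\<close>, the poles with \<open>j < N\<close> are only simple. This costs little in the sizes
  of the coefficients and remainders, while for many \<open>k\<close> the \<open>k\<close>-th cyclotomic factor of the
  common denominator is then needed only once instead of twice. The resulting
  exponent is strictly smaller than \<open>\<rho>\<close>. The size of the denominator follows from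
  \<open>\<Sum>\<^sub>k\<^sub>\<le>\<^sub>n ln (cyc p k) \<sim> (3 ln p / \<pi>\<^sup>2) n\<^sup>2\<close>. Irrationality follows from
  finiteness, as a rational number \<open>a/b\<close> is approximated with error zero by all \<open>ka/kb\<close>.
\<close>

section \<open>Cyclotomic factors of \<open>p ^ m - 1\<close>\<close>

text \<open>Let s = 6 / pi^2. For n = 16 N the classical coefficients and remainders have sizes p ^
  ((320 + 256 s) N^2) and p ^ (- (320 - 256 s) N^2) up to lower order, where 256 s comes from the
  common denominator, and \<rho> - 1 is the quotient (5/4 + s) / (5/4 - s) of these rates. Making N
  of the poles simple replaces the two numbers 320 by 625/2 and 311, which alone makes the quotient
  slightly worse. The saved cyclotomic factors subtract (33/2) s (1/2^2 + ... + 1/8^2) from 256 s in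
  both places, and this more than pays. The block of simple poles is a fixed fraction of n, because
  only a gain of order N^2 is visible in the exponent. Nonvanishing is free: the remainder is a
  series of nonnegative terms whose first 16 N terms vanish, and it agrees with its first nonzero
  term up to a factor p ^ O(N).\<close>

text \<open>These are the values at \<open>p\<close> of the cyclotomic polynomials. A prime power \<open>x\<close> divides
  \<open>p ^ m - 1\<close> iff \<open>ord x p\<close> divides \<open>m\<close>, so grouping the prime powers by their order
  gives integral factors without any theory of cyclotomic polynomials.\<close>

definition cyc :: "nat \<Rightarrow> nat \<Rightarrow> nat" where
  "cyc p d = (\<Prod>x\<in>{x. primepow x \<and> ord x p = d}. aprimedivisor x)"

lemma primepow_ord_finite:
  fixes p d :: nat
  assumes "p \<ge> 2" "d \<ge> 1"
  shows "finite {x. primepow x \<and> ord x p = d}"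
proof (rule finite_subset)
  have "1 < p ^ d" using assms by (intro one_less_power) auto
  then show "finite {x. x dvd p ^ d - 1}" by simp
  show "{x. primepow x \<and> ord x p = d} \<subseteq> {x. x dvd p ^ d - 1}"
  proof
    fix x assume "x \<in> {x. primepow x \<and> ord x p = d}"
    then have "[p ^ d = 1] (mod x)" by (subst ord_divides) auto
    then show "x \<in> {x. x dvd p ^ d - 1}"
      using \<open>1 < p ^ d\<close> by (simp add: cong_altdef_nat)
  qed
qed

lemma aprimedivisor_primepow_pos: "primepow x \<Longrightarrow> aprimedivisor x > (0::nat)"
  by (metis aprimedivisor_pos_nat primepow_gt_Suc_0 One_nat_def)

lemma cyc_pos: "cyc p d > 0"
  unfolding cyc_def by (intro prod_pos) (auto intro: aprimedivisor_primepow_pos)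

text \<open>Summing \<open>mangoldt\<close> over the divisors of p ^ m - 1 gives its logarithm, so p
  ^ m - 1 is the product of the underlying primes of all prime powers dividing it. The order of p
  sorts these prime powers into the classes d dvd m.\<close>

lemma prod_cyc:
  assumes "p \<ge> 2" "m \<ge> 1"
  shows "(\<Prod>d | d dvd m. cyc p d) = p ^ m - 1"
proof -
  have gt: "1 < p ^ m" using assms by (intro one_less_power) auto
  have "(\<Prod>d | d dvd m. cyc p d) = (\<Prod>x\<in>(\<Union>d\<in>{d. d dvd m}. {x. primepow x \<and> ord x p = d}). aprimedivisor x)"
    unfolding cyc_def
  proof (rule prod.UNION_disjoint [symmetric])
    show "\<forall>i\<in>{d. d dvd m}. finite {x. primepow x \<and> ord x p = i}"
      using assms by (auto intro!: primepow_ord_finite simp: Suc_le_eq dest: dvd_pos_nat [rotated])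
  qed (use assms in auto)
  also have "(\<Union>d\<in>{d. d dvd m}. {x. primepow x \<and> ord x p = d}) = {x. primepow x \<and> ord x p dvd m}"
    by auto
  also have "\<dots> = {x. primepow x \<and> x dvd p ^ m - 1}"
    using gt by (simp only: ord_divides [symmetric] cong_altdef_nat less_imp_le)
  finally have *: "(\<Prod>d | d dvd m. cyc p d) = (\<Prod>x | primepow x \<and> x dvd p ^ m - 1. aprimedivisor x)" .
  have fin: "finite {x. primepow x \<and> x dvd p ^ m - 1}"
    by (rule finite_subset [of _ "{x. x dvd p ^ m - 1}"]) (use gt in auto)
  have "ln (real (\<Prod>x | primepow x \<and> x dvd p ^ m - 1. aprimedivisor x)) =
      (\<Sum>x | primepow x \<and> x dvd p ^ m - 1. ln (real (aprimedivisor x)))"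
    unfolding of_nat_prod using fin
    by (intro ln_prod) (auto intro: aprimedivisor_primepow_pos)
  also have "\<dots> = (\<Sum>x | x dvd p ^ m - 1. mangoldt x)"
    using gt by (intro sum.mono_neutral_cong_left) (auto simp: mangoldt_def)
  also have "\<dots> = ln (real (p ^ m - 1))"
    using gt by (subst mangoldt_sum) auto
  finally have "ln (real (\<Prod>x | primepow x \<and> x dvd p ^ m - 1. aprimedivisor x)) = ln (real (p ^ m - 1))" .
  moreover have "(\<Prod>x | primepow x \<and> x dvd p ^ m - 1. aprimedivisor x) > 0"
    by (intro prod_pos) (auto intro: aprimedivisor_primepow_pos)
  ultimately have "real (\<Prod>x | primepow x \<and> x dvd p ^ m - 1. aprimedivisor x) = real (p ^ m - 1)"
    using gt by (subst (asm) ln_inj_iff) (auto simp del: of_nat_prod of_nat_diff)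
  then show ?thesis unfolding * by (simp only: of_nat_eq_iff)
qed

section \<open>Growth of the partial sums of \<open>ln (cyc p k)\<close>\<close>

definition cyc_psi :: "nat \<Rightarrow> nat \<Rightarrow> real" where
  "cyc_psi p n = (\<Sum>k=1..n. ln (real (cyc p k)))"

text \<open>Both sides run over the pairs (m, k) with k dvd m, sorted by m or by the cofactor m div
  k. It is the analogue of Chebyshev's identity between ln (n!) and the values of psi at n /
  d.\<close>

lemma sum_cyc_psi:
  assumes "p \<ge> 2"
  shows "(\<Sum>d=1..n. cyc_psi p (n div d)) = (\<Sum>m=1..n. ln (real (p ^ m - 1)))"
proof -
  have "(\<Sum>m=1..n. ln (real (p ^ m - 1))) = (\<Sum>m=1..n. \<Sum>k | k dvd m. ln (real (cyc p k)))"
  proof (intro sum.cong refl)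
    fix m assume "m \<in> {1..n}"
    then have m: "m \<ge> 1" by auto
    show "ln (real (p ^ m - 1)) = (\<Sum>k | k dvd m. ln (real (cyc p k)))"
      unfolding prod_cyc [OF assms m, symmetric] of_nat_prod using m
      by (intro ln_prod) (auto simp: cyc_pos)
  qed
  also have "\<dots> = (\<Sum>(m,k)\<in>(SIGMA m:{1..n}. {k. k dvd m}). ln (real (cyc p k)))"
    by (subst sum.Sigma) auto
  also have "\<dots> = (\<Sum>(d,k)\<in>(SIGMA d:{1..n}. {1..n div d}). ln (real (cyc p k)))"
  proof (rule sum.reindex_bij_witness [where i = "\<lambda>(d,k). (d * k, k)" and j = "\<lambda>(m,k). (m div k, k)"])
    fix x :: "nat \<times> nat" assume "x \<in> (SIGMA d:{1..n}. {1..n div d})"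
    then obtain d k where x: "x = (d, k)" "1 \<le> d" "1 \<le> k" "k * d \<le> n"
      by (auto simp: less_eq_div_iff_mult_less_eq Suc_le_eq)
    then show "(case x of (d, k) \<Rightarrow> (d * k, k)) \<in> (SIGMA m:{1..n}. {k. k dvd m})"
      by (auto simp: mult.commute)
  next
    fix x :: "nat \<times> nat" assume "x \<in> (SIGMA m:{1..n}. {k. k dvd m})"
    then obtain d k where x: "x = (k * d, k)" "1 \<le> k * d" "k * d \<le> n"
      by (auto elim!: dvdE)
    then have "0 < k" "0 < d" by auto
    then have "d \<le> n" using \<open>k * d \<le> n\<close> by (metis Suc_leI mult_le_mono1 nat_mult_1 order_trans One_nat_def)
    then show "(case x of (m, k) \<Rightarrow> (m div k, k)) \<in> (SIGMA d:{1..n}. {1..n div d})"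
      using x \<open>0 < k\<close> \<open>0 < d\<close> by (auto simp: less_eq_div_iff_mult_less_eq)
  qed (auto elim!: dvdE)
  also have "\<dots> = (\<Sum>d=1..n. cyc_psi p (n div d))"
    unfolding cyc_psi_def by (subst sum.Sigma) auto
  finally show ?thesis by simp
qed

lemma sum_inverse_squares_le: "(\<Sum>d=1..n. 1 / (real d)\<^sup>2) \<le> pi\<^sup>2 / 6"
proof -
  have "(\<Sum>d=1..n. 1 / (real d)\<^sup>2) = (\<Sum>d<n. 1 / (real d + 1)\<^sup>2)"
    by (rule sum.reindex_bij_witness [where i = Suc and j = "\<lambda>d. d - 1"]) (auto simp: add_ac)
  also have "\<dots> \<le> (\<Sum>d. 1 / (real d + 1)\<^sup>2)"
    using sums_summable [OF inverse_squares_sums] by (intro sum_le_suminf) (auto simp: add_ac)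
  also have "\<dots> = pi\<^sup>2 / 6"
    using sums_unique [OF inverse_squares_sums] by (simp add: add_ac)
  finally show ?thesis .
qed

text \<open>The upper bound gives zeta(2) - 1 <= 65/100 for the contraction below and 6 / pi^2 >
  6/10 for the final comparison; the lower bound gives 6 / pi^2 < 2/3.\<close>

lemma pi_square_bounds: "9 < pi\<^sup>2" "pi\<^sup>2 < 99 / 10"
proof -
  have "3\<^sup>2 < pi\<^sup>2" using pi_gt3 by (intro power_strict_mono) auto
  then show "9 < pi\<^sup>2" by simp
  have "pi\<^sup>2 \<le> (3.1415926535899)\<^sup>2" using pi_approx by (intro power_mono) auto
  also have "\<dots> < 99 / 10" by (simp add: power2_eq_square)
  finally show "pi\<^sup>2 < 99 / 10" .
qed

text \<open>Turns linear errors into the form \<epsilon> * n^2 + K used throughout. Such bounds hold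
  for all n, so they can be applied at n div d, which may be small.\<close>

lemma linear_le_quadratic:
  fixes K \<epsilon> x :: real
  assumes "\<epsilon> > 0"
  shows "K * x \<le> \<epsilon> * x\<^sup>2 + K\<^sup>2 / \<epsilon>"
proof -
  have "0 \<le> (\<epsilon> * x - K)\<^sup>2 + (\<epsilon> * x)\<^sup>2 + K\<^sup>2" by simp
  also have "\<dots> = 2 * \<epsilon> * (\<epsilon> * x\<^sup>2 + K\<^sup>2 / \<epsilon> - K * x)"
    using assms by (simp add: field_simps power2_eq_square)
  finally have "0 \<le> 2 * \<epsilon> * (\<epsilon> * x\<^sup>2 + K\<^sup>2 / \<epsilon> - K * x)" .
  then show ?thesis using assms by (simp add: zero_le_mult_iff)
qed

text \<open>The weight of the terms with \<open>d \<ge> 2\<close> is \<open>\<zeta>(2) - 1 < 1\<close>, which makes the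
  relation a contraction for the constant in \<open>E n = O(n\<^sup>2)\<close>; no Moebius inversion is needed.\<close>

lemma small_of_sum_div_small:
  fixes E :: "nat \<Rightarrow> real"
  assumes bound: "\<And>n. \<bar>E n\<bar> \<le> C * (real n)\<^sup>2"
    and sum: "\<And>\<epsilon>. \<epsilon> > 0 \<Longrightarrow> \<exists>K. \<forall>n. \<bar>\<Sum>d=1..n. E (n div d)\<bar> \<le> \<epsilon> * (real n)\<^sup>2 + K"
    and "\<epsilon> > 0"
  shows "\<exists>K. \<forall>n. \<bar>E n\<bar> \<le> \<epsilon> * (real n)\<^sup>2 + K"
proof -
  define P where "P c \<longleftrightarrow> (\<exists>K. \<forall>n. \<bar>E n\<bar> \<le> c * (real n)\<^sup>2 + K)" for c
  \<comment> \<open>3/4 = 65/100 + 1/20 + 1/20: the terms with d >= 2, the hypothesis on the divisor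
    sum, and the accumulated constants n * K absorbed by \<open>linear_le_quadratic\<close>.\<close>
  have step: "P (3 / 4 * c)" if "P c" "c > 0" for c
  proof -
    obtain K where K: "\<And>n. \<bar>E n\<bar> \<le> c * (real n)\<^sup>2 + K"
      using \<open>P c\<close> unfolding P_def by blast
    have K0: "K \<ge> 0" using K [of 0] by simp
    obtain K' where K': "\<And>n. \<bar>\<Sum>d=1..n. E (n div d)\<bar> \<le> c / 20 * (real n)\<^sup>2 + K'"
      using sum [of "c / 20"] \<open>c > 0\<close> by auto
    define K2 where "K2 = K' + K\<^sup>2 / (c / 20)"
    have "\<bar>E n\<bar> \<le> 3 / 4 * c * (real n)\<^sup>2 + K2" if "n \<ge> 1" for n
    proof -
      have tail: "(\<Sum>d=2..n. 1 / (real d)\<^sup>2) \<le> 65 / 100"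
        using sum_inverse_squares_le [of n] pi_square_bounds that
        by (subst (asm) sum.atLeast_Suc_atMost) (auto simp: numeral_2_eq_2)
      have "(\<Sum>d=1..n. E (n div d)) = E n + (\<Sum>d=2..n. E (n div d))"
        using that by (subst sum.atLeast_Suc_atMost) (auto simp: numeral_2_eq_2)
      then have "\<bar>E n\<bar> \<le> \<bar>\<Sum>d=1..n. E (n div d)\<bar> + \<bar>\<Sum>d=2..n. E (n div d)\<bar>"
        by linarith
      also have "\<bar>\<Sum>d=2..n. E (n div d)\<bar> \<le> (\<Sum>d=2..n. \<bar>E (n div d)\<bar>)"
        by (rule sum_abs)
      also have "\<dots> \<le> (\<Sum>d=2..n. c * (real n)\<^sup>2 * (1 / (real d)\<^sup>2) + K)"
      proof (rule sum_mono)
        fix d assume "d \<in> {2..n}"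
        have "(real (n div d))\<^sup>2 \<le> (real n / real d)\<^sup>2"
          by (intro power_mono of_nat_div_le_of_nat) auto
        then have "c * (real (n div d))\<^sup>2 \<le> c * (real n / real d)\<^sup>2"
          using \<open>c > 0\<close> by (intro mult_left_mono) auto
        then show "\<bar>E (n div d)\<bar> \<le> c * (real n)\<^sup>2 * (1 / (real d)\<^sup>2) + K"
          using K [of "n div d"] by (simp add: power_divide)
      qed
      also have "\<dots> \<le> c * (real n)\<^sup>2 * (65 / 100) + real n * K"
      proof -
        have "(\<Sum>d=2..n. c * (real n)\<^sup>2 * (1 / (real d)\<^sup>2)) \<le> c * (real n)\<^sup>2 * (65 / 100)"
          unfolding sum_distrib_left [symmetric] using tail \<open>c > 0\<close> by (intro mult_left_mono) auto
        moreover have "(\<Sum>d=2..n. K) \<le> real n * K"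
          using K0 by (simp add: mult_right_mono)
        ultimately show ?thesis by (simp only: sum.distrib)
      qed
      finally show ?thesis
        using K' [of n] linear_le_quadratic [of "c / 20" K "real n"] \<open>c > 0\<close>
        by (simp add: K2_def algebra_simps)
    qed
    then have "\<bar>E n\<bar> \<le> 3 / 4 * c * (real n)\<^sup>2 + max K2 K" for n
      using K [of n] by (cases "n = 0") (auto intro: order_trans [OF _ add_left_mono [OF max.cobounded1]])
    then show ?thesis unfolding P_def by blast
  qed
  define C' where "C' = max C 1"
  have "\<bar>E n\<bar> \<le> C' * (real n)\<^sup>2" for n
    using bound [of n] mult_right_mono [of C C' "(real n)\<^sup>2"] by (simp add: C'_def)
  then have "P C'" unfolding P_def by (intro exI [of _ 0]) auto
  then have iter: "P ((3 / 4) ^ k * C')" for k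
    by (induction k) (auto dest: step simp: C'_def max_def mult.assoc)
  obtain k where "(3 / 4 :: real) ^ k < \<epsilon> / C'"
    using real_arch_pow_inv [of "\<epsilon> / C'" "3 / 4"] \<open>\<epsilon> > 0\<close> by (auto simp: C'_def)
  then have le: "(3 / 4) ^ k * C' \<le> \<epsilon>"
    by (simp add: C'_def field_simps)
  obtain K where "\<And>n. \<bar>E n\<bar> \<le> (3 / 4) ^ k * C' * (real n)\<^sup>2 + K"
    using iter [of k] unfolding P_def by blast
  then have "\<bar>E n\<bar> \<le> \<epsilon> * (real n)\<^sup>2 + K" for n
    using mult_right_mono [OF le, of "(real n)\<^sup>2"] by (meson add_right_mono order_trans zero_le_power2)
  then show ?thesis by blast
qed

lemma ln_power_minus_one_bounds:
  fixes p m :: nat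
  assumes "p \<ge> 2" "m \<ge> 1"
  shows "(real m - 1) * ln (real p) \<le> ln (real (p ^ m - 1))" "ln (real (p ^ m - 1)) \<le> real m * ln (real p)"
proof -
  have gt: "1 < p ^ m" using assms by (intro one_less_power) auto
  obtain k where k: "m = Suc k" using assms by (cases m) auto
  have "2 * p ^ k \<le> p ^ m" using assms by (simp add: k)
  moreover have "1 \<le> p ^ k" using assms by (simp add: Suc_le_eq)
  ultimately have "p ^ k \<le> p ^ m - 1" by linarith
  then have "ln (real (p ^ k)) \<le> ln (real (p ^ m - 1))"
    using assms gt by (subst ln_le_cancel_iff) (auto simp del: of_nat_power of_nat_diff)
  then show "(real m - 1) * ln (real p) \<le> ln (real (p ^ m - 1))"
    using assms by (simp add: k ln_realpow)
  have "ln (real (p ^ m - 1)) \<le> ln (real (p ^ m))"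
    using assms gt by (subst ln_le_cancel_iff) (auto simp del: of_nat_power of_nat_diff)
  then show "ln (real (p ^ m - 1)) \<le> real m * ln (real p)"
    using assms by (simp add: ln_realpow)
qed

lemma sum_real_Icc: "(\<Sum>m=1..n. real m) = real n * (real n + 1) / 2"
  by (induction n) (auto simp: field_simps)

lemma sum_ln_power_minus_one_bounds:
  fixes p n :: nat
  assumes "p \<ge> 2"
  shows "\<bar>(\<Sum>m=1..n. ln (real (p ^ m - 1))) - ln (real p) * (real n)\<^sup>2 / 2\<bar> \<le> ln (real p) * real n / 2"
proof -
  have "(\<Sum>m=1..n. ln (real (p ^ m - 1))) \<le> (\<Sum>m=1..n. real m * ln (real p))"
    using assms by (intro sum_mono ln_power_minus_one_bounds) auto
  also have "\<dots> = ln (real p) * (real n)\<^sup>2 / 2 + ln (real p) * real n / 2"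
    unfolding sum_distrib_right [symmetric] sum_real_Icc by (simp add: field_simps power2_eq_square)
  finally have 1: "(\<Sum>m=1..n. ln (real (p ^ m - 1))) \<le> \<dots>" .
  have "ln (real p) * (real n)\<^sup>2 / 2 - ln (real p) * real n / 2 = (\<Sum>m=1..n. (real m - 1) * ln (real p))"
    unfolding sum_distrib_right [symmetric] sum_subtractf sum_real_Icc
    by (simp add: field_simps power2_eq_square)
  also have "\<dots> \<le> (\<Sum>m=1..n. ln (real (p ^ m - 1)))"
    using assms by (intro sum_mono ln_power_minus_one_bounds) auto
  finally show ?thesis using 1 by linarith
qed

text \<open>Rounding n / d down costs about 2 n / d in the square, which would sum to n * ln n.
  Bounding 2 x by \<delta> * x^2 + 1 / \<delta> term by term leaves only a small multiple of the
  main term and a linear error.\<close>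

lemma sum_div_squares:
  fixes \<epsilon> :: real
  assumes "\<epsilon> > 0"
  shows "\<exists>K. \<forall>n. \<bar>(\<Sum>d=1..n. (real (n div d))\<^sup>2) - pi\<^sup>2 / 6 * (real n)\<^sup>2\<bar> \<le> \<epsilon> * (real n)\<^sup>2 + K"
proof -
  define \<delta> where "\<delta> = \<epsilon> / 4"
  have "\<delta> > 0" using assms by (simp add: \<delta>_def)
  define H where "H n = (\<Sum>d=1..n. 1 / (real d)\<^sup>2)" for n
  have "H \<longlonglongrightarrow> pi\<^sup>2 / 6"
  proof -
    have "H n = (\<Sum>d<n. 1 / (real d + 1)\<^sup>2)" for n unfolding H_def
      by (rule sum.reindex_bij_witness [where i = Suc and j = "\<lambda>d. d - 1"]) (auto simp: add_ac)
    then have "H = (\<lambda>n. \<Sum>d<n. 1 / (real d + 1)\<^sup>2)" by blast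
    then show ?thesis using inverse_squares_sums by (simp add: sums_def add_ac)
  qed
  then obtain n0 where n0: "\<And>n. n \<ge> n0 \<Longrightarrow> \<bar>H n - pi\<^sup>2 / 6\<bar> < \<delta>"
    using \<open>\<delta> > 0\<close> by (auto simp: LIMSEQ_iff)
  define K where "K = 2 * (real n0)\<^sup>2 + (1 / \<delta>)\<^sup>2 / \<delta>"
  have H_le: "H n \<le> pi\<^sup>2 / 6" for n unfolding H_def by (rule sum_inverse_squares_le)
  have H_pos: "H n \<ge> 0" for n unfolding H_def by (intro sum_nonneg) auto
  have "\<bar>(\<Sum>d=1..n. (real (n div d))\<^sup>2) - pi\<^sup>2 / 6 * (real n)\<^sup>2\<bar> \<le> \<epsilon> * (real n)\<^sup>2 + K" for n
  proof -
    have up: "(\<Sum>d=1..n. (real (n div d))\<^sup>2) \<le> H n * (real n)\<^sup>2"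
      unfolding H_def sum_distrib_right
    proof (rule sum_mono)
      fix d
      have "(real (n div d))\<^sup>2 \<le> (real n / real d)\<^sup>2"
        by (intro power_mono of_nat_div_le_of_nat) auto
      then show "(real (n div d))\<^sup>2 \<le> 1 / (real d)\<^sup>2 * (real n)\<^sup>2"
        by (simp add: power_divide)
    qed
    have "(1 - \<delta>) * (H n * (real n)\<^sup>2) - real n / \<delta> = (\<Sum>d=1..n. (1 - \<delta>) * (real n / real d)\<^sup>2 - 1 / \<delta>)"
      by (simp add: H_def sum_subtractf sum_distrib_left sum_distrib_right power_divide)
    also have "\<dots> \<le> (\<Sum>d=1..n. (real (n div d))\<^sup>2)"
    proof (rule sum_mono)
      fix d assume "d \<in> {1..n}"
      define x where "x = real n / real d"
      have "real (n div d) = of_int \<lfloor>x\<rfloor>"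
        by (simp add: x_def floor_divide_of_nat_eq)
      then have "real (n div d) > x - 1" by linarith
      moreover have "x \<ge> 1" using \<open>d \<in> {1..n}\<close> by (simp add: x_def)
      ultimately have "(x - 1)\<^sup>2 \<le> (real (n div d))\<^sup>2" by (intro power_mono) auto
      moreover have "0 \<le> (\<delta> * x - 1)\<^sup>2 / \<delta>" using \<open>\<delta> > 0\<close> by simp
      then have "2 * x \<le> \<delta> * x\<^sup>2 + 1 / \<delta>"
        using \<open>\<delta> > 0\<close> by (simp add: field_simps power2_eq_square)
      ultimately show "(1 - \<delta>) * (real n / real d)\<^sup>2 - 1 / \<delta> \<le> (real (n div d))\<^sup>2"
        unfolding x_def [symmetric] by (simp add: algebra_simps power2_eq_square)
    qed
    finally have low: "(1 - \<delta>) * (H n * (real n)\<^sup>2) - real n / \<delta> \<le> (\<Sum>d=1..n. (real (n div d))\<^sup>2)" .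
    have "(pi\<^sup>2 / 6 - H n) * (real n)\<^sup>2 \<le> \<delta> * (real n)\<^sup>2 + 2 * (real n0)\<^sup>2"
    proof (cases "n \<ge> n0")
      case True
      then have "(pi\<^sup>2 / 6 - H n) * (real n)\<^sup>2 \<le> \<delta> * (real n)\<^sup>2"
        using n0 [of n] by (intro mult_right_mono) auto
      then show ?thesis using zero_le_power2 [of "real n0"] by linarith
    next
      case False
      then have "(pi\<^sup>2 / 6 - H n) * (real n)\<^sup>2 \<le> 2 * (real n0)\<^sup>2"
        using pi_square_bounds H_pos [of n] by (intro mult_mono power_mono) auto
      moreover have "\<delta> * (real n)\<^sup>2 \<ge> 0" using \<open>\<delta> > 0\<close> by simp
      ultimately show ?thesis by linarith
    qed
    moreover have "real n / \<delta> \<le> \<delta> * (real n)\<^sup>2 + (1 / \<delta>)\<^sup>2 / \<delta>"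
      using linear_le_quadratic [of \<delta> "1 / \<delta>" "real n"] \<open>\<delta> > 0\<close> by simp
    moreover have "\<delta> * (H n * (real n)\<^sup>2) \<le> \<delta> * (2 * (real n)\<^sup>2)"
      using pi_square_bounds H_le [of n] \<open>\<delta> > 0\<close> by (intro mult_left_mono mult_right_mono) auto
    moreover have "H n * (real n)\<^sup>2 \<le> pi\<^sup>2 / 6 * (real n)\<^sup>2"
      by (intro mult_right_mono H_le) auto
    moreover have "\<epsilon> * (real n)\<^sup>2 = 4 * (\<delta> * (real n)\<^sup>2)" by (simp add: \<delta>_def)
    moreover have "K \<ge> 0" "\<epsilon> * (real n)\<^sup>2 \<ge> 0" using \<open>\<delta> > 0\<close> assms by (auto simp: K_def)
    ultimately show ?thesis using up low unfolding K_def left_diff_distrib by linarith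
  qed
  then show ?thesis by blast
qed

text \<open>The constant c = 3 * ln p / pi^2 satisfies c * pi^2 / 6 = ln p / 2. Hence the quadratic
  terms cancel when c * n^2 is subtracted from \<open>cyc_psi p n\<close> in
  \<open>sum_cyc_psi\<close>, and the contraction carries the smallness of the summed error over to
  the error itself.\<close>

theorem cyc_psi_asymp:
  fixes \<epsilon> :: real
  assumes "p \<ge> 2" "\<epsilon> > 0"
  shows "\<exists>K. \<forall>n. \<bar>cyc_psi p n - 3 * ln (real p) / pi\<^sup>2 * (real n)\<^sup>2\<bar> \<le> \<epsilon> * (real n)\<^sup>2 + K"
proof (rule small_of_sum_div_small [OF _ _ \<open>\<epsilon> > 0\<close>])
  define L where "L = ln (real p)"
  define c where "c = 3 * L / pi\<^sup>2"
  have "L > 0" using assms by (simp add: L_def)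
  then have "c > 0" by (simp add: c_def)
  have psi_nonneg: "cyc_psi p n \<ge> 0" for n
    unfolding cyc_psi_def using cyc_pos by (intro sum_nonneg) (simp add: Suc_le_eq)
  \<comment> \<open>The a priori quadratic bound from which the contraction starts: all terms are
    nonnegative, so the one with d = 1 is at most the whole sum.\<close>
  have psi_le: "cyc_psi p n \<le> L * (real n)\<^sup>2" for n
  proof (cases "n = 0")
    case False
    have "cyc_psi p n = cyc_psi p (n div 1)" by simp
    also have "\<dots> \<le> (\<Sum>d=1..n. cyc_psi p (n div d))"
      using False psi_nonneg by (intro member_le_sum) auto
    also have "\<dots> \<le> L * (real n)\<^sup>2 / 2 + L * real n / 2"
      using sum_ln_power_minus_one_bounds [OF \<open>p \<ge> 2\<close>, of n]
      unfolding sum_cyc_psi [OF \<open>p \<ge> 2\<close>] L_def by linarith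
    also have "L * real n \<le> L * (real n)\<^sup>2"
      using False \<open>L > 0\<close> by (intro mult_left_mono) (auto simp: power2_eq_square)
    finally show ?thesis by simp
  qed (simp add: cyc_psi_def)
  show "\<bar>cyc_psi p n - 3 * ln (real p) / pi\<^sup>2 * (real n)\<^sup>2\<bar> \<le> (L + c) * (real n)\<^sup>2" for n
  proof -
    have "c * (real n)\<^sup>2 \<ge> 0" "L * (real n)\<^sup>2 \<ge> 0" using \<open>c > 0\<close> \<open>L > 0\<close> by auto
    then show ?thesis
      using psi_nonneg [of n] psi_le [of n]
      unfolding L_def [symmetric] c_def [symmetric] distrib_right by linarith
  qed
  fix \<delta> :: real assume "\<delta> > 0"
  obtain K where K: "\<And>n. \<bar>(\<Sum>d=1..n. (real (n div d))\<^sup>2) - pi\<^sup>2 / 6 * (real n)\<^sup>2\<bar>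
      \<le> (\<delta> / (2 * c)) * (real n)\<^sup>2 + K"
    using sum_div_squares [of "\<delta> / (2 * c)"] \<open>c > 0\<close> \<open>\<delta> > 0\<close> by auto
  have "\<bar>\<Sum>d=1..n. cyc_psi p (n div d) - 3 * ln (real p) / pi\<^sup>2 * (real (n div d))\<^sup>2\<bar>
      \<le> \<delta> * (real n)\<^sup>2 + (c * K + (L / 2)\<^sup>2 / (\<delta> / 2))" for n
  proof -
    define S where "S = (\<Sum>d=1..n. (real (n div d))\<^sup>2)"
    define U where "U = (\<Sum>m=1..n. ln (real (p ^ m - 1)))"
    have "(\<Sum>d=1..n. cyc_psi p (n div d) - 3 * ln (real p) / pi\<^sup>2 * (real (n div d))\<^sup>2) = U - c * S"
      unfolding sum_subtractf sum_cyc_psi [OF \<open>p \<ge> 2\<close>] sum_distrib_left [symmetric]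
      by (simp add: U_def S_def c_def L_def)
    also have "\<dots> = (U - L * (real n)\<^sup>2 / 2) - c * (S - pi\<^sup>2 / 6 * (real n)\<^sup>2)"
      by (simp add: c_def algebra_simps)
    also have "\<bar>\<dots>\<bar> \<le> \<bar>U - L * (real n)\<^sup>2 / 2\<bar> + c * \<bar>S - pi\<^sup>2 / 6 * (real n)\<^sup>2\<bar>"
      using \<open>c > 0\<close> abs_triangle_ineq4 [of "U - L * (real n)\<^sup>2 / 2" "c * (S - pi\<^sup>2 / 6 * (real n)\<^sup>2)"]
      by (simp add: abs_mult)
    also have "\<dots> \<le> L * real n / 2 + c * ((\<delta> / (2 * c)) * (real n)\<^sup>2 + K)"
      using K [of n] \<open>c > 0\<close> sum_ln_power_minus_one_bounds [OF \<open>p \<ge> 2\<close>, of n]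
      by (intro add_mono mult_left_mono) (auto simp: U_def S_def L_def)
    also have "\<dots> = L / 2 * real n + \<delta> / 2 * (real n)\<^sup>2 + c * K"
      using \<open>c > 0\<close> by (simp add: field_simps)
    also have "L / 2 * real n \<le> \<delta> / 2 * (real n)\<^sup>2 + (L / 2)\<^sup>2 / (\<delta> / 2)"
      using \<open>\<delta> > 0\<close> by (intro linear_le_quadratic) auto
    finally show ?thesis by (simp add: algebra_simps)
  qed
  then show "\<exists>K. \<forall>n. \<bar>\<Sum>d=1..n. cyc_psi p (n div d) - 3 * ln (real p) / pi\<^sup>2 * (real (n div d))\<^sup>2\<bar>
      \<le> \<delta> * (real n)\<^sup>2 + K" by blast
qed

section \<open>A criterion for irrationality measures\<close>

lemma real_squares_tail:
  fixes c d K :: real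
  assumes "d < c"
  shows "eventually (\<lambda>N::nat. d * (real N)\<^sup>2 + K < c * (real N - 1)\<^sup>2) sequentially"
  using assms by real_asymp

text \<open>For an approximation u / v, take the least N with |v| * exp (- B * N^2) <= 1/2. If u / v
  differs from a N / b N, the integer b N * u - a N * v has absolute value less than 1 although it
  is nonzero. If they agree, the distance to z is exactly r N / |b N|, which \<open>lower\<close>
  keeps too large. So nothing about determinants of consecutive forms is required. The bound
  \<open>lower\<close> is relative to b N because a common factor of b N and r N, known only from
  above in size, cancels there.\<close>

lemma finite_rational_approximations:
  fixes z A B \<rho> :: real and a b :: "nat \<Rightarrow> int" and r :: "nat \<Rightarrow> real"
  assumes r: "\<And>N. r N = of_int (b N) * z - of_int (a N)"
    and pos: "\<And>N. N \<ge> N0 \<Longrightarrow> r N > 0"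
    and upper: "\<And>N. N \<ge> N0 \<Longrightarrow> r N \<le> exp (- B * (real N)\<^sup>2)"
    and b_le: "\<And>N. N \<ge> N0 \<Longrightarrow> \<bar>of_int (b N)\<bar> \<le> exp (A * (real N)\<^sup>2)"
    and lower: "\<And>N. N \<ge> N0 \<Longrightarrow> \<bar>of_int (b N)\<bar> * exp (- (A + B) * (real N)\<^sup>2) \<le> r N"
    and AB: "B > 0" "A > 0" "A < (\<rho> - 1) * B"
  shows "finite {(u :: int, v :: int). v \<noteq> 0 \<and>
           \<bar>z - real_of_int u / real_of_int v\<bar> \<le> \<bar>real_of_int v\<bar> powr (- \<rho>)}"
proof -
  have "\<rho> > 1" using AB by (smt (verit) mult_nonpos_nonneg)
  have "eventually (\<lambda>N. N > N0 \<and> N > 0 \<and>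
      A * (real N)\<^sup>2 + (ln 2 + (\<rho> - 1) * ln 2) < ((\<rho> - 1) * B) * (real N - 1)\<^sup>2 \<and>
      (A + B) * (real N)\<^sup>2 + \<rho> * ln 2 < (\<rho> * B) * (real N - 1)\<^sup>2) sequentially"
    using AB by (intro eventually_conj real_squares_tail eventually_gt_at_top) (auto simp: algebra_simps)
  then obtain N1 where N1: "\<And>N. N \<ge> N1 \<Longrightarrow> N > N0 \<and> N > 0 \<and>
      A * (real N)\<^sup>2 + (ln 2 + (\<rho> - 1) * ln 2) < ((\<rho> - 1) * B) * (real N - 1)\<^sup>2 \<and>
      (A + B) * (real N)\<^sup>2 + \<rho> * ln 2 < (\<rho> * B) * (real N - 1)\<^sup>2"
    by (auto simp: eventually_sequentially)
  define V where "V = exp (B * (real N1)\<^sup>2)"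
  have main: "\<bar>real_of_int v\<bar> \<le> V"
    if "v \<noteq> 0" and approx: "\<bar>z - real_of_int u / real_of_int v\<bar> \<le> \<bar>real_of_int v\<bar> powr (- \<rho>)" for u v :: int
  proof (rule ccontr)
    assume big: "\<not> \<bar>real_of_int v\<bar> \<le> V"
    define t where "t = ln \<bar>real_of_int v\<bar>"
    have v_exp: "\<bar>real_of_int v\<bar> = exp t" using \<open>v \<noteq> 0\<close> by (simp add: t_def)
    have "exp (B * (real N1)\<^sup>2) < exp t" using big by (simp add: V_def v_exp)
    then have t_gt: "B * (real N1)\<^sup>2 < t" by simp
    define P where "P N \<longleftrightarrow> t - B * (real N)\<^sup>2 \<le> - ln 2" for N :: nat
    have "eventually (\<lambda>N::nat. t + ln 2 \<le> B * (real N)\<^sup>2) sequentially"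
      using AB(1) by real_asymp
    then obtain Nx where "P Nx" unfolding P_def eventually_sequentially by (force simp: algebra_simps)
    \<comment> \<open>Minimality gives t > B * (N - 1)^2 - ln 2. The loss from N to N - 1 is linear
      in N in the exponent and is absorbed by the strict inequality A < (\<rho> - 1) * B.\<close>
    define N where "N = (LEAST N. P N)"
    have PN: "P N" unfolding N_def by (rule LeastI) fact
    have "N > N1"
    proof (rule ccontr)
      assume "\<not> N > N1"
      then have "B * (real N)\<^sup>2 \<le> B * (real N1)\<^sup>2" using AB by (intro mult_left_mono power_mono) auto
      with PN t_gt show False unfolding P_def using ln_gt_zero [of "2::real"] by linarith
    qed
    then have N: "N > N0" "N > 0"
      and N_A: "A * (real N)\<^sup>2 + (ln 2 + (\<rho> - 1) * ln 2) < ((\<rho> - 1) * B) * (real N - 1)\<^sup>2"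
      and N_G: "(A + B) * (real N)\<^sup>2 + \<rho> * ln 2 < (\<rho> * B) * (real N - 1)\<^sup>2"
      using N1 [of N] by auto
    have "\<not> P (N - 1)" using \<open>N > 0\<close> unfolding N_def by (intro not_less_Least) auto
    then have t_low: "t > B * (real N - 1)\<^sup>2 - ln 2"
      using \<open>N > 0\<close> by (simp add: P_def of_nat_diff)
    have vz: "\<bar>real_of_int v\<bar> * \<bar>z - real_of_int u / real_of_int v\<bar> \<le> exp ((1 - \<rho>) * t)"
    proof -
      have "\<bar>real_of_int v\<bar> * \<bar>z - real_of_int u / real_of_int v\<bar> \<le> exp t * exp (- \<rho> * t)"
        using approx unfolding v_exp by (intro mult_left_mono) (auto simp: powr_def)
      also have "\<dots> = exp ((1 - \<rho>) * t)" by (simp add: exp_add [symmetric] algebra_simps)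
      finally show ?thesis .
    qed
    define \<Delta> where "\<Delta> = b N * u - a N * v"
    show False
    proof (cases "\<Delta> = 0")
      case False
      have id: "real_of_int \<Delta> = - (of_int (b N) * (of_int v * (z - of_int u / of_int v))) + of_int v * r N"
        using \<open>v \<noteq> 0\<close> by (simp add: \<Delta>_def r field_simps)
      have "1 \<le> \<bar>real_of_int \<Delta>\<bar>" using False by linarith
      also have "\<dots> \<le> \<bar>of_int (b N)\<bar> * (\<bar>of_int v\<bar> * \<bar>z - of_int u / of_int v\<bar>) + \<bar>of_int v\<bar> * r N"
        unfolding id using pos [of N] N by (intro order_trans [OF abs_triangle_ineq]) (simp add: abs_mult)
      also have "\<dots> \<le> exp (A * (real N)\<^sup>2) * exp ((1 - \<rho>) * t) + exp t * exp (- B * (real N)\<^sup>2)"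
        using b_le [of N] upper [of N] less_imp_le [OF pos [of N]] N vz unfolding v_exp by (intro add_mono mult_mono) auto
      also have "exp t * exp (- B * (real N)\<^sup>2) \<le> exp (- ln 2)"
        using PN unfolding P_def by (simp add: exp_add [symmetric])
      also have "exp (- ln 2) = (1 / 2 :: real)" by (simp add: exp_minus)
      finally have "1 / 2 \<le> exp (A * (real N)\<^sup>2 + (1 - \<rho>) * t)" by (simp add: exp_add)
      moreover have "(\<rho> - 1) * (B * (real N - 1)\<^sup>2 - ln 2) \<le> (\<rho> - 1) * t"
        using t_low \<open>\<rho> > 1\<close> by (intro mult_left_mono) auto
      then have "A * (real N)\<^sup>2 + (1 - \<rho>) * t < - ln 2"
        using N_A by (simp add: algebra_simps)
      then have "exp (A * (real N)\<^sup>2 + (1 - \<rho>) * t) < exp (- ln 2)" by simp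
      then have "exp (A * (real N)\<^sup>2 + (1 - \<rho>) * t) < 1 / 2" by (simp add: exp_minus)
      ultimately show False by linarith
    next
      case True
      then have eq: "real_of_int (b N) * of_int u = of_int (a N) * of_int v"
        unfolding \<Delta>_def by (simp flip: of_int_mult)
      have rN: "r N > 0" using pos N by simp
      have b0: "b N \<noteq> 0"
      proof
        assume "b N = 0"
        then have "a N = 0" using eq \<open>v \<noteq> 0\<close> by simp
        with \<open>b N = 0\<close> rN show False by (simp add: r)
      qed
      have "r N = of_int (b N) * (z - of_int u / of_int v)"
        using eq \<open>v \<noteq> 0\<close> by (simp add: r field_simps)
      then have rb: "r N = \<bar>of_int (b N)\<bar> * \<bar>z - of_int u / of_int v\<bar>"
        using rN by (metis abs_mult abs_of_pos)
      have "\<bar>of_int (b N)\<bar> * exp (- (A + B) * (real N)\<^sup>2) \<le> \<bar>of_int (b N)\<bar> * \<bar>z - of_int u / of_int v\<bar>"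
        using lower [of N] N rb by simp
      then have "exp (- (A + B) * (real N)\<^sup>2) \<le> \<bar>z - of_int u / of_int v\<bar>"
        using b0 by (subst (asm) mult_le_cancel_left_pos) auto
      also have "\<dots> \<le> exp (- \<rho> * t)" using approx v_exp by (simp add: powr_def)
      finally have "\<rho> * t \<le> (A + B) * (real N)\<^sup>2" by (simp add: algebra_simps)
      moreover have "\<rho> * (B * (real N - 1)\<^sup>2 - ln 2) \<le> \<rho> * t"
        using t_low \<open>\<rho> > 1\<close> by (intro mult_left_mono) auto
      ultimately show False using N_G by (simp add: algebra_simps)
    qed
  qed
  define R where "R = V * (\<bar>z\<bar> + 1)"
  have "{(u :: int, v :: int). v \<noteq> 0 \<and> \<bar>z - real_of_int u / real_of_int v\<bar> \<le> \<bar>real_of_int v\<bar> powr (- \<rho>)}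
      \<subseteq> {- \<lceil>R\<rceil>..\<lceil>R\<rceil>} \<times> {- \<lceil>V\<rceil>..\<lceil>V\<rceil>}"
  proof clarify
    fix u v :: int
    assume v: "v \<noteq> 0" and approx: "\<bar>z - real_of_int u / real_of_int v\<bar> \<le> \<bar>real_of_int v\<bar> powr (- \<rho>)"
    have vV: "\<bar>real_of_int v\<bar> \<le> V" using main v approx by blast
    have "\<bar>real_of_int v\<bar> \<ge> 1" using v by linarith
    then have "\<bar>real_of_int v\<bar> powr (- \<rho>) \<le> 1"
      using \<open>\<rho> > 1\<close> by (simp add: powr_minus inverse_le_1_iff ge_one_powr_ge_zero)
    then have "\<bar>real_of_int u / real_of_int v\<bar> \<le> \<bar>z\<bar> + 1" using approx by linarith
    then have "\<bar>real_of_int v\<bar> * \<bar>real_of_int u / real_of_int v\<bar> \<le> V * (\<bar>z\<bar> + 1)"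
      using vV by (intro mult_mono) auto
    then have "\<bar>real_of_int u\<bar> \<le> R" using v by (simp add: R_def abs_divide)
    then show "u \<in> {- \<lceil>R\<rceil>..\<lceil>R\<rceil>} \<and> v \<in> {- \<lceil>V\<rceil>..\<lceil>V\<rceil>}"
      using vV by (auto; linarith)
  qed
  then show ?thesis by (rule finite_subset) auto
qed

lemma irrational_if_finite_approximations:
  fixes z \<rho> :: real
  assumes "finite {(u :: int, v :: int). v \<noteq> 0 \<and>
           \<bar>z - real_of_int u / real_of_int v\<bar> \<le> \<bar>real_of_int v\<bar> powr (- \<rho>)}"
  shows "z \<notin> \<rat>"
proof
  assume "z \<in> \<rat>"
  then obtain u v :: int where uv: "v \<noteq> 0" "z = of_int u / of_int v"
    by (metis Rats_cases' of_int_0_less_iff less_irrefl)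
  have "(\<lambda>k. (int (Suc k) * u, int (Suc k) * v)) ` UNIV \<subseteq> {(u :: int, v :: int). v \<noteq> 0 \<and>
           \<bar>z - real_of_int u / real_of_int v\<bar> \<le> \<bar>real_of_int v\<bar> powr (- \<rho>)}"
    using uv by (auto simp del: of_nat_Suc)
  then have "finite (range (\<lambda>k. (int (Suc k) * u, int (Suc k) * v)))"
    using assms finite_subset by blast
  moreover have "inj (\<lambda>k. (int (Suc k) * u, int (Suc k) * v))"
    using uv by (auto intro!: injI)
  ultimately show False using finite_imageD infinite_UNIV_nat by blast
qed

section \<open>The series\<close>

text \<open>Both series are the nonnegative double series of k * q ^ (k * l), summed over l first or
  over k first.\<close>

lemma zeta_q2_sums:
  fixes q :: real
  assumes q: "0 < q" "q < 1"
  shows "(\<lambda>l. q ^ Suc l / (1 - q ^ Suc l)\<^sup>2) sums zeta_q2 q"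
proof -
  define f where "f = (\<lambda>(k, l). real (Suc k) * (q ^ Suc l) ^ Suc k)"
  have f_nonneg: "f x \<ge> 0" for x using q by (auto simp: f_def split: prod.split)
  have lt1: "q ^ Suc k < 1" for k using q by (intro power_Suc_less_one) auto
  have row: "((\<lambda>l. f (k, l)) has_sum (real (Suc k) * q ^ Suc k / (1 - q ^ Suc k))) UNIV" for k
  proof (rule sums_nonneg_imp_has_sum)
    have eq: "(q ^ Suc l) ^ Suc k = q ^ Suc k * (q ^ Suc k) ^ l" for l
      by (simp only: power_mult [symmetric] power_add [symmetric]) (simp add: algebra_simps)
    have "(\<lambda>l. real (Suc k) * q ^ Suc k * (q ^ Suc k) ^ l) sums (real (Suc k) * q ^ Suc k * (1 / (1 - q ^ Suc k)))"
      using lt1 [of k] q by (intro sums_mult geometric_sums) auto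
    then show "(\<lambda>l. f (k, l)) sums (real (Suc k) * q ^ Suc k / (1 - q ^ Suc k))"
      by (simp only: f_def eq split mult.assoc times_divide_eq_right mult_1_right)
  qed (rule f_nonneg)
  have col: "((\<lambda>k. f (k, l)) has_sum (q ^ Suc l / (1 - q ^ Suc l)\<^sup>2)) UNIV" for l
  proof (rule sums_nonneg_imp_has_sum)
    have "(\<lambda>k. q ^ Suc l * (of_nat (Suc k) * (q ^ Suc l) ^ k)) sums (q ^ Suc l * (1 / (1 - q ^ Suc l)\<^sup>2))"
      using lt1 [of l] q by (intro sums_mult geometric_deriv_sums) auto
    then show "(\<lambda>k. f (k, l)) sums (q ^ Suc l / (1 - q ^ Suc l)\<^sup>2)"
      by (simp add: f_def mult_ac)
  qed (rule f_nonneg)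
  have total: "((\<lambda>k. real (Suc k) * q ^ Suc k / (1 - q ^ Suc k)) has_sum zeta_q2 q) UNIV"
    unfolding zeta_q2_def using q lt1
    by (intro sums_nonneg_imp_has_sum summable_sums summable_zeta_q2) (auto simp: less_imp_le)
  have sm: "f summable_on (UNIV \<times> UNIV)"
    by (rule summable_on_SigmaI [OF row]) (use total f_nonneg in \<open>auto simp: summable_on_def\<close>)
  then have "(f has_sum zeta_q2 q) (UNIV \<times> UNIV)"
    by (intro has_sum_SigmaI [OF row total]) auto
  then have "((\<lambda>(l, k). f (k, l)) has_sum zeta_q2 q) (UNIV \<times> UNIV)"
    by (subst (asm) has_sum_swap)
  then have "((\<lambda>l. q ^ Suc l / (1 - q ^ Suc l)\<^sup>2) has_sum zeta_q2 q) UNIV"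
    by (rule has_sum_SigmaD) (use col in auto)
  then show ?thesis by (rule has_sum_imp_sums)
qed

section \<open>Contributions of pairs of poles\<close>

definition harm1 :: "real \<Rightarrow> nat \<Rightarrow> real" where
  "harm1 P j = (\<Sum>l=1..j. 1 / (P ^ l - 1))"

definition harm2 :: "real \<Rightarrow> nat \<Rightarrow> real" where
  "harm2 P j = (\<Sum>l=1..j. P ^ l / (P ^ l - 1)\<^sup>2)"

lemma sum_lessThan_Suc_shift: "(\<Sum>l<j. f (Suc l)) = (\<Sum>l=1..j. f l)"
  by (rule sum.reindex_bij_witness [where i = "\<lambda>l. l - 1" and j = Suc]) auto

text \<open>Up to the factor P ^ j, the t-th term is the term of index t + j in the series of
  \<open>zeta_q2_sums\<close>, so a coincident pair of poles contributes a tail of that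
  series.\<close>

lemma double_pole_sums:
  fixes P :: real
  assumes P: "P > 1"
  shows "(\<lambda>t. P ^ Suc t / ((P ^ Suc t * P ^ j - 1)\<^sup>2)) sums ((zeta_q2 (1 / P) - harm2 P j) / P ^ j)"
proof -
  have ne: "P ^ Suc l \<noteq> 1" for l using one_less_power [OF P, of "Suc l"] by simp
  have "(1 / P) ^ Suc l / (1 - (1 / P) ^ Suc l)\<^sup>2 = P ^ Suc l / (P ^ Suc l - 1)\<^sup>2" for l
    using P ne [of l] by (simp add: power_one_over divide_simps power2_eq_square del: power_Suc)
  then have "(\<lambda>l. P ^ Suc l / (P ^ Suc l - 1)\<^sup>2) sums zeta_q2 (1 / P)"
    using zeta_q2_sums [of "1 / P"] P by simp
  then have "(\<lambda>t. P ^ Suc (t + j) / (P ^ Suc (t + j) - 1)\<^sup>2) sums (zeta_q2 (1 / P) - (\<Sum>l<j. P ^ Suc l / (P ^ Suc l - 1)\<^sup>2))"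
    by (rule sums_split_initial_segment)
  then have "(\<lambda>t. P ^ Suc (t + j) / (P ^ Suc (t + j) - 1)\<^sup>2 / P ^ j) sums ((zeta_q2 (1 / P) - harm2 P j) / P ^ j)"
    unfolding harm2_def sum_lessThan_Suc_shift [where f = "\<lambda>l. P ^ l / (P ^ l - 1)\<^sup>2", symmetric]
    by (rule sums_divide)
  then show ?thesis using P by (simp add: power_add mult.assoc)
qed

lemma summable_inverse_power_minus_one:
  fixes P :: real
  assumes "P > 1"
  shows "summable (\<lambda>l. 1 / (P ^ Suc l - 1))"
proof (rule summable_comparison_test')
  show "summable (\<lambda>l. 1 / (P - 1) * (1 / P) ^ l)"
    using assms by (intro summable_mult summable_geometric) auto
  fix l :: nat
  have "1 \<le> P ^ l" using assms by (intro one_le_power) auto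
  then have "(P - 1) * P ^ l \<le> P ^ Suc l - 1" using assms by (simp add: algebra_simps)
  moreover have "0 < (P - 1) * P ^ l" using assms by simp
  ultimately have "1 / (P ^ Suc l - 1) \<le> 1 / ((P - 1) * P ^ l)" "0 \<le> 1 / (P ^ Suc l - 1)"
    by (auto intro!: divide_left_mono mult_pos_pos simp del: power_Suc)
  then show "norm (1 / (P ^ Suc l - 1)) \<le> 1 / (P - 1) * (1 / P) ^ l"
    by (simp add: power_one_over)
qed

text \<open>After partial fractions both parts are tails of the same series of 1 / (P ^ l - 1). Its
  value Z, a third and unwanted number, cancels; only finite sums remain.\<close>

lemma distinct_poles_sums:
  fixes P :: real
  assumes P: "P > 1" and "i \<noteq> j"
  shows "(\<lambda>t. P ^ Suc t / ((P ^ Suc t * P ^ i - 1) * (P ^ Suc t * P ^ j - 1)))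
           sums ((harm1 P i - harm1 P j) / (P ^ i - P ^ j))"
proof -
  define Z where "Z = (\<Sum>l. 1 / (P ^ Suc l - 1))"
  have tail: "(\<lambda>t. 1 / (P ^ Suc (t + k) - 1)) sums (Z - harm1 P k)" for k
    unfolding harm1_def sum_lessThan_Suc_shift [where f = "\<lambda>l. 1 / (P ^ l - 1)", symmetric] Z_def
    by (intro sums_split_initial_segment summable_sums summable_inverse_power_minus_one P)
  have ne: "P ^ Suc t * P ^ k - 1 \<noteq> 0" for t k
    using one_less_power [OF P, of "Suc t + k"] by (simp add: power_add mult.assoc)
  have ij: "P ^ i - P ^ j \<noteq> 0" using assms by (simp add: power_inject_exp)
  have "(\<lambda>t. (1 / (P ^ Suc (t + j) - 1) - 1 / (P ^ Suc (t + i) - 1)) / (P ^ i - P ^ j))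
      sums (((Z - harm1 P j) - (Z - harm1 P i)) / (P ^ i - P ^ j))"
    by (intro sums_divide sums_diff tail)
  moreover have "(1 / (P ^ Suc (t + j) - 1) - 1 / (P ^ Suc (t + i) - 1)) / (P ^ i - P ^ j)
      = P ^ Suc t / ((P ^ Suc t * P ^ i - 1) * (P ^ Suc t * P ^ j - 1))" for t
  proof -
    define x where "x = P ^ Suc t"
    have "P ^ Suc (t + k) = x * P ^ k" for k by (simp add: x_def power_add)
    then show ?thesis using ne [of t i] ne [of t j] ij unfolding x_def [symmetric]
      by (simp add: divide_simps) (simp add: algebra_simps)
  qed
  ultimately show ?thesis by simp
qed

section \<open>Partial fractions\<close>

lemma pderiv_sum: "pderiv (\<Sum>i\<in>A. f i) = (\<Sum>i\<in>A. pderiv (f i))"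
  by (induction A rule: infinite_finite_induct) (auto simp: pderiv_add)

text \<open>The coefficient of 1 / (x * c j - 1) in the partial fraction decomposition of Q /
  (\<Prod>i. x * c i - 1), written down by Lagrange interpolation at the nodes 1 / c j.\<close>

definition pole_coeff :: "'i set \<Rightarrow> ('i \<Rightarrow> real) \<Rightarrow> real poly \<Rightarrow> 'i \<Rightarrow> real" where
  "pole_coeff B c Q j = poly Q (1 / c j) / (\<Prod>i\<in>B - {j}. c i / c j - 1)"

context
  fixes B :: "'i set" and c :: "'i \<Rightarrow> real" and Q :: "real poly"
  assumes fin: "finite B" and inj: "inj_on c B" and c0: "\<And>i. i \<in> B \<Longrightarrow> c i \<noteq> 0"
    and deg: "degree Q < card B"
begin

lemma pole_factor_nonzero: "i \<in> B \<Longrightarrow> j \<in> B \<Longrightarrow> i \<noteq> j \<Longrightarrow> c i / c j - 1 \<noteq> 0"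
  using inj c0 by (auto simp: inj_on_def)

text \<open>Lagrange interpolation: both sides have degree below \<open>card B\<close> and agree at
  the \<open>card B\<close> nodes.\<close>

lemma poly_eq_sum_pole_coeff:
  "Q = (\<Sum>j\<in>B. Polynomial.smult (pole_coeff B c Q j) (\<Prod>i\<in>B - {j}. [:- 1, c i:]))"
proof (rule poly_eqI_degree)
  have inj': "inj_on (\<lambda>i. 1 / c i) B" using inj c0 by (auto simp: inj_on_def field_simps)
  then have card: "card ((\<lambda>i. 1 / c i) ` B) = card B" by (rule card_image)
  show "degree Q < card ((\<lambda>i. 1 / c i) ` B)" using deg card by simp
  have "degree (\<Sum>j\<in>B. Polynomial.smult (pole_coeff B c Q j) (\<Prod>i\<in>B - {j}. [:- 1, c i:])) \<le> card B - 1"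
  proof (rule degree_sum_le [OF fin])
    fix j assume "j \<in> B"
    have "degree (\<Prod>i\<in>B - {j}. [:- 1, c i:]) \<le> sum (degree \<circ> (\<lambda>i. [:- 1, c i:])) (B - {j})"
      by (rule degree_prod_sum_le) (use fin in auto)
    also have "\<dots> \<le> (\<Sum>i\<in>B - {j}. 1)" by (rule sum_mono) auto
    also have "\<dots> = card B - 1" using fin \<open>j \<in> B\<close> by simp
    finally show "degree (Polynomial.smult (pole_coeff B c Q j) (\<Prod>i\<in>B - {j}. [:- 1, c i:])) \<le> card B - 1"
      using degree_smult_le order_trans by blast
  qed
  then show "degree (\<Sum>j\<in>B. Polynomial.smult (pole_coeff B c Q j) (\<Prod>i\<in>B - {j}. [:- 1, c i:])) < card ((\<lambda>i. 1 / c i) ` B)"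
    using card deg by linarith
  fix x assume "x \<in> (\<lambda>i. 1 / c i) ` B"
  then obtain j where j: "j \<in> B" "x = 1 / c j" by auto
  have "poly (\<Sum>j\<in>B. Polynomial.smult (pole_coeff B c Q j) (\<Prod>i\<in>B - {j}. [:- 1, c i:])) x =
      (\<Sum>k\<in>B. pole_coeff B c Q k * (\<Prod>i\<in>B - {k}. c i / c j - 1))"
    by (simp add: poly_sum poly_prod j)
  also have "\<dots> = (\<Sum>k\<in>{j}. pole_coeff B c Q k * (\<Prod>i\<in>B - {k}. c i / c j - 1))"
  proof (rule sum.mono_neutral_right)
    show "\<forall>k\<in>B - {j}. pole_coeff B c Q k * (\<Prod>i\<in>B - {k}. c i / c j - 1) = 0"
      using fin j c0 by (auto intro!: bexI [of _ j])
  qed (use fin j in auto)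
  also have "\<dots> = poly Q x"
  proof -
    have "(\<Prod>i\<in>B - {j}. c i / c j - 1) \<noteq> 0"
      unfolding prod_zero_iff [OF finite_Diff [OF fin]] using pole_factor_nonzero j(1) by blast
    then show ?thesis by (simp add: pole_coeff_def j)
  qed
  finally show "poly Q x = poly (\<Sum>j\<in>B. Polynomial.smult (pole_coeff B c Q j) (\<Prod>i\<in>B - {j}. [:- 1, c i:])) x"
    by simp
qed

lemma partial_fractions:
  assumes x: "\<And>i. i \<in> B \<Longrightarrow> x * c i - 1 \<noteq> 0"
  shows "poly Q x / (\<Prod>i\<in>B. x * c i - 1) = (\<Sum>j\<in>B. pole_coeff B c Q j / (x * c j - 1))"
proof -
  have "poly Q x = (\<Sum>j\<in>B. pole_coeff B c Q j * (\<Prod>i\<in>B - {j}. x * c i - 1))"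
    by (subst poly_eq_sum_pole_coeff) (simp add: poly_sum poly_prod)
  also have "\<dots> / (\<Prod>i\<in>B. x * c i - 1) = (\<Sum>j\<in>B. pole_coeff B c Q j / (x * c j - 1))"
    unfolding sum_divide_distrib
  proof (rule sum.cong)
    fix j assume "j \<in> B"
    then have "(\<Prod>i\<in>B. x * c i - 1) = (x * c j - 1) * (\<Prod>i\<in>B - {j}. x * c i - 1)"
      using fin by (simp add: prod.remove)
    moreover have "(\<Prod>i\<in>B - {j}. x * c i - 1) \<noteq> 0" using fin x by auto
    ultimately show "pole_coeff B c Q j * (\<Prod>i\<in>B - {j}. x * c i - 1) / (\<Prod>i\<in>B. x * c i - 1) =
        pole_coeff B c Q j / (x * c j - 1)" by simp
  qed simp
  finally show ?thesis .
qed

text \<open>The left side is the constant term of the expansion at the j-th pole in powers of x * c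
  j - 1. It equals the coefficient of the pole times a logarithmic derivative, which yields a
  product of \<open>pole_coeff\<close> with simple fractions instead of a sum over other weights.
  The proof differentiates the interpolation formula at the node.\<close>

lemma regular_part:
  assumes j: "j \<in> B" and nz: "poly Q (1 / c j) \<noteq> 0"
  shows "(\<Sum>k\<in>B - {j}. pole_coeff B c Q k / (c k / c j - 1)) =
    pole_coeff B c Q j * (poly (pderiv Q) (1 / c j) / (c j * poly Q (1 / c j))
      - (\<Sum>k\<in>B - {j}. (c k / c j) / (c k / c j - 1)))"
proof -
  define w where "w = pole_coeff B c Q"
  define l where "l k = c k / c j - 1" for k
  define W where "W = (\<Prod>i\<in>B - {j}. l i)"
  have l0: "l k \<noteq> 0" if "k \<in> B - {j}" for k
    using pole_factor_nonzero j that by (auto simp: l_def)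
  then have W0: "W \<noteq> 0" using fin by (simp add: W_def)
  have lj: "l j = 0" using c0 j by (simp add: l_def)
  have split: "(\<Prod>i\<in>B - {j} - {k}. l i) = W / l k" if "k \<in> B - {j}" for k
    using fin l0 that unfolding W_def by (subst prod.remove [of "B - {j}" k]) auto
  have "poly (pderiv Q) (1 / c j) = (\<Sum>k\<in>B. w k * (\<Sum>i\<in>B - {k}. c i * (\<Prod>m\<in>B - {k} - {i}. l m)))"
    by (subst poly_eq_sum_pole_coeff)
       (simp add: pderiv_sum pderiv_smult pderiv_prod poly_sum poly_prod w_def l_def pderiv_pCons)
  also have "\<dots> = w j * (\<Sum>i\<in>B - {j}. c i * (\<Prod>m\<in>B - {j} - {i}. l m))
      + (\<Sum>k\<in>B - {j}. w k * (\<Sum>i\<in>B - {k}. c i * (\<Prod>m\<in>B - {k} - {i}. l m)))"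
    using fin j by (simp add: sum.remove)
  also have "(\<Sum>i\<in>B - {j}. c i * (\<Prod>m\<in>B - {j} - {i}. l m)) = (\<Sum>i\<in>B - {j}. W * (c i / l i))"
    by (intro sum.cong refl) (simp add: split)
  also have "(\<Sum>k\<in>B - {j}. w k * (\<Sum>i\<in>B - {k}. c i * (\<Prod>m\<in>B - {k} - {i}. l m))) =
      (\<Sum>k\<in>B - {j}. W * c j * (w k / l k))"
  proof (intro sum.cong refl)
    fix k assume k: "k \<in> B - {j}"
    \<comment> \<open>For k different from j every product that still contains \<open>l j\<close>
      vanishes, so only the term in which the j-th factor was differentiated survives.\<close>
    have "(\<Sum>i\<in>B - {k}. c i * (\<Prod>m\<in>B - {k} - {i}. l m)) = (\<Sum>i\<in>{j}. c i * (\<Prod>m\<in>B - {k} - {i}. l m))"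
    proof (rule sum.mono_neutral_right)
      show "\<forall>i\<in>B - {k} - {j}. c i * (\<Prod>m\<in>B - {k} - {i}. l m) = 0"
        using fin j lj k by (auto intro!: bexI [of _ j])
    qed (use fin j k in auto)
    moreover have "B - {k} - {j} = B - {j} - {k}" by auto
    then have "(\<Sum>i\<in>{j}. c i * (\<Prod>m\<in>B - {k} - {i}. l m)) = W / l k * c j"
      using split [OF k] by simp
    ultimately show "w k * (\<Sum>i\<in>B - {k}. c i * (\<Prod>m\<in>B - {k} - {i}. l m)) = W * c j * (w k / l k)"
      by (simp only: ac_simps times_divide_eq_right times_divide_eq_left)
  qed
  finally have "poly (pderiv Q) (1 / c j) =
      W * (w j * (\<Sum>i\<in>B - {j}. c i / l i) + c j * (\<Sum>k\<in>B - {j}. w k / l k))"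
    unfolding sum_distrib_left [symmetric] by (simp only: distrib_left ac_simps)
  moreover have "poly Q (1 / c j) = w j * W"
    using W0 by (simp add: w_def pole_coeff_def W_def l_def)
  moreover have "(\<Sum>i\<in>B - {j}. (c i / c j) / l i) = (\<Sum>i\<in>B - {j}. c i / l i) / c j"
    by (simp add: sum_divide_distrib mult.commute)
  ultimately show ?thesis
    using W0 c0 [OF j] nz unfolding w_def [symmetric] l_def [symmetric]
    by (simp add: divide_simps)
qed

end

section \<open>Linear forms in \<open>1\<close> and \<open>\<zeta>\<^sub>q(2)\<close>\<close>

locale linear_form =
  fixes P :: real and e n :: nat
  assumes P: "P > 1" and en: "e \<le> n"
begin

text \<open>\<open>wt1\<close> and \<open>wt2\<close> are the coefficients in the partial fraction decompositions of the two
  factors with simple poles \<open>P ^ - j\<close> whose product (times \<open>x\<close>) is \<open>summand x\<close>; \<open>logder1\<close> and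
  \<open>logder2\<close> are the logarithmic derivatives, at a pole, of the respective factor
  without its pole.\<close>

definition wt1 :: "nat \<Rightarrow> real" where
  "wt1 i = 1 / (\<Prod>k\<in>{e..n} - {i}. P ^ k / P ^ i - 1)"

definition wt2 :: "nat \<Rightarrow> real" where
  "wt2 j = (\<Prod>s=1..n. 1 / P ^ j - P ^ s) / (\<Prod>k\<in>{0..n} - {j}. P ^ k / P ^ j - 1)"

definition logder1 :: "nat \<Rightarrow> real" where
  "logder1 j = - (\<Sum>k\<in>{e..n} - {j}. (P ^ k / P ^ j) / (P ^ k / P ^ j - 1))"

definition logder2 :: "nat \<Rightarrow> real" where
  "logder2 j = (\<Sum>s=1..n. 1 / (1 - P ^ (s + j))) - (\<Sum>k\<in>{0..n} - {j}. (P ^ k / P ^ j) / (P ^ k / P ^ j - 1))"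

text \<open>The value at \<open>P ^ - j\<close>, for \<open>j < e\<close>, of the first factor.\<close>

definition single_pole_factor :: "nat \<Rightarrow> real" where
  "single_pole_factor j = 1 / (\<Prod>k\<in>{e..n}. P ^ k / P ^ j - 1)"

definition summand :: "real \<Rightarrow> real" where
  "summand x = x * (\<Prod>s=1..n. x - P ^ s) / ((\<Prod>i=e..n. x * P ^ i - 1) * (\<Prod>i=0..n. x * P ^ i - 1))"

lemma inj_on_powers: "inj_on (\<lambda>k. P ^ k) A"
  using P by (auto simp: inj_on_def power_inject_exp)

definition zeros_poly :: "real poly" where
  "zeros_poly = (\<Prod>s=1..n. [:- (P ^ s), 1:])"

lemma degree_zeros_poly: "degree zeros_poly = n"
  unfolding zeros_poly_def by (subst degree_prod_sum_eq) auto

lemma poly_zeros_poly: "poly zeros_poly x = (\<Prod>s=1..n. x - P ^ s)"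
  by (simp add: zeros_poly_def poly_prod)

lemma node_minus_zero: "1 / P ^ j - P ^ s \<noteq> 0" if "s \<ge> 1"
proof -
  have "1 / P ^ j \<le> 1" "P ^ s > 1" using P that by (auto simp: one_le_power one_less_power)
  then show ?thesis by linarith
qed

lemma logder_zeros_poly:
  "poly (pderiv zeros_poly) (1 / P ^ j) / (P ^ j * poly zeros_poly (1 / P ^ j)) = (\<Sum>s=1..n. 1 / (1 - P ^ (s + j)))"
proof -
  define W where "W = (\<Prod>s=1..n. 1 / P ^ j - P ^ s)"
  have "W \<noteq> 0" using node_minus_zero by (auto simp: W_def)
  have "poly (pderiv zeros_poly) (1 / P ^ j) = (\<Sum>s=1..n. \<Prod>r\<in>{1..n} - {s}. 1 / P ^ j - P ^ r)"
    by (simp add: zeros_poly_def pderiv_prod pderiv_pCons poly_sum poly_prod)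
  also have "\<dots> = (\<Sum>s=1..n. W * (1 / (1 / P ^ j - P ^ s)))"
  proof (intro sum.cong refl)
    fix s assume "s \<in> {1..n}"
    then show "(\<Prod>r\<in>{1..n} - {s}. 1 / P ^ j - P ^ r) = W * (1 / (1 / P ^ j - P ^ s))"
      using node_minus_zero [of s j] unfolding W_def by (subst prod.remove [of "{1..n}" s]) auto
  qed
  also have "\<dots> = W * (\<Sum>s=1..n. 1 / (1 / P ^ j - P ^ s))" by (simp add: sum_distrib_left)
  finally have "poly (pderiv zeros_poly) (1 / P ^ j) / (P ^ j * poly zeros_poly (1 / P ^ j)) =
      (\<Sum>s=1..n. 1 / (1 / P ^ j - P ^ s)) / P ^ j"
    using \<open>W \<noteq> 0\<close> by (simp add: poly_zeros_poly W_def)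
  also have "\<dots> = (\<Sum>s=1..n. 1 / (1 - P ^ (s + j)))"
    unfolding sum_divide_distrib
  proof (intro sum.cong refl)
    fix s
    have "(1 / P ^ j - P ^ s) * P ^ j = 1 - P ^ (s + j)"
      using P by (simp add: left_diff_distrib power_add)
    then show "1 / (1 / P ^ j - P ^ s) / P ^ j = 1 / (1 - P ^ (s + j))"
      by (simp only: divide_divide_eq_left)
  qed
  finally show ?thesis .
qed

lemma wt1_eq: "wt1 = pole_coeff {e..n} (\<lambda>k. P ^ k) 1"
  unfolding wt1_def pole_coeff_def by (simp add: fun_eq_iff)

lemma wt2_eq: "wt2 = pole_coeff {0..n} (\<lambda>k. P ^ k) zeros_poly"
  by (simp add: wt2_def pole_coeff_def fun_eq_iff poly_zeros_poly)

lemma wt1_partial_fractions: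
  assumes "\<And>i. i \<in> {e..n} \<Longrightarrow> x * P ^ i - 1 \<noteq> 0"
  shows "1 / (\<Prod>i=e..n. x * P ^ i - 1) = (\<Sum>i=e..n. wt1 i / (x * P ^ i - 1))"
  unfolding wt1_eq using partial_fractions [OF _ inj_on_powers, of "{e..n}" 1 x] P en assms by simp

lemma wt2_partial_fractions:
  assumes "\<And>i. i \<in> {0..n} \<Longrightarrow> x * P ^ i - 1 \<noteq> 0"
  shows "(\<Prod>s=1..n. x - P ^ s) / (\<Prod>i=0..n. x * P ^ i - 1) = (\<Sum>j=0..n. wt2 j / (x * P ^ j - 1))"
  unfolding wt2_eq poly_zeros_poly [symmetric]
  using partial_fractions [OF _ inj_on_powers, of "{0..n}" zeros_poly x] P degree_zeros_poly assms by simp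

text \<open>This sum is what multiplies \<open>wt2 j * harm1 P j\<close> once the off-diagonal pole
  pairs are sorted by their harmonic sums.\<close>

lemma wt1_regular_part:
  assumes "j \<in> {e..n}"
  shows "(\<Sum>i\<in>{e..n} - {j}. wt1 i / (P ^ j - P ^ i)) = - (wt1 j * logder1 j) / P ^ j"
proof -
  have "(\<Sum>i\<in>{e..n} - {j}. wt1 i / (P ^ i / P ^ j - 1)) = wt1 j * logder1 j"
    unfolding wt1_eq logder1_def
    using regular_part [OF _ inj_on_powers, of "{e..n}" 1 j] P en assms by simp
  moreover have "(\<Sum>i\<in>{e..n} - {j}. wt1 i / (P ^ j - P ^ i)) =
      (\<Sum>i\<in>{e..n} - {j}. - (wt1 i / (P ^ i / P ^ j - 1)) / P ^ j)"
  proof (intro sum.cong refl)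
    fix i assume "i \<in> {e..n} - {j}"
    then have "P ^ i \<noteq> P ^ j" using P by (auto simp: power_inject_exp)
    then show "wt1 i / (P ^ j - P ^ i) = - (wt1 i / (P ^ i / P ^ j - 1)) / P ^ j"
      using P by (simp add: field_simps)
  qed
  ultimately show ?thesis
    by (simp only: sum_negf sum_divide_distrib [symmetric])
qed

text \<open>For j < e the point P ^ - j is not a pole of the first factor, so the partial fraction
  sum there is simply the value of that factor.\<close>

lemma wt1_regular_part_outside:
  assumes "j < e"
  shows "(\<Sum>i=e..n. wt1 i / (P ^ j - P ^ i)) = - single_pole_factor j / P ^ j"
proof -
  have ne: "P ^ i \<noteq> P ^ j" if "i \<in> {e..n}" for i using that P assms by (simp add: power_inject_exp)
  have "single_pole_factor j = (\<Sum>i=e..n. wt1 i / (1 / P ^ j * P ^ i - 1))"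
    unfolding single_pole_factor_def using ne P
    by (subst wt1_partial_fractions [symmetric]) (auto simp: field_simps)
  also have "\<dots> = (\<Sum>i=e..n. (- (P ^ j)) * (wt1 i / (P ^ j - P ^ i)))"
  proof (intro sum.cong refl)
    fix i assume "i \<in> {e..n}"
    have "w / (1 / a * b - 1) = (- a) * (w / (a - b))" if "a \<noteq> 0" "a \<noteq> b" for a b w :: real
      using that by (simp add: divide_simps) (simp add: algebra_simps)
    then show "wt1 i / (1 / P ^ j * P ^ i - 1) = (- (P ^ j)) * (wt1 i / (P ^ j - P ^ i))"
      using ne [OF \<open>i \<in> {e..n}\<close>] P by (metis power_not_zero less_numeral_extra(2) not_one_less_zero)
  qed
  finally have "single_pole_factor j = (- (P ^ j)) * (\<Sum>i=e..n. wt1 i / (P ^ j - P ^ i))"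
    by (simp only: sum_distrib_left)
  then show ?thesis using P by simp
qed

lemma wt2_regular_part:
  assumes "j \<in> {0..n}"
  shows "(\<Sum>i\<in>{0..n} - {j}. wt2 i / (P ^ j - P ^ i)) = - (wt2 j * logder2 j) / P ^ j"
proof -
  have "poly zeros_poly (1 / P ^ j) \<noteq> 0"
    using node_minus_zero by (auto simp: poly_zeros_poly)
  then have "(\<Sum>i\<in>{0..n} - {j}. wt2 i / (P ^ i / P ^ j - 1)) = wt2 j * logder2 j"
    unfolding wt2_eq logder2_def logder_zeros_poly [symmetric]
    using regular_part [OF _ inj_on_powers, of "{0..n}" zeros_poly j] P degree_zeros_poly assms by simp
  moreover have "(\<Sum>i\<in>{0..n} - {j}. wt2 i / (P ^ j - P ^ i)) =
      (\<Sum>i\<in>{0..n} - {j}. - (wt2 i / (P ^ i / P ^ j - 1)) / P ^ j)"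
  proof (intro sum.cong refl)
    fix i assume "i \<in> {0..n} - {j}"
    then have "P ^ i \<noteq> P ^ j" using P by (auto simp: power_inject_exp)
    then show "wt2 i / (P ^ j - P ^ i) = - (wt2 i / (P ^ i / P ^ j - 1)) / P ^ j"
      using P by (simp add: field_simps)
  qed
  ultimately show ?thesis
    by (simp only: sum_negf sum_divide_distrib [symmetric])
qed

definition pole_pair :: "nat \<Rightarrow> nat \<Rightarrow> real" where
  "pole_pair i j = (if i = j then (zeta_q2 (1 / P) - harm2 P j) / P ^ j
     else (harm1 P i - harm1 P j) / (P ^ i - P ^ j))"

lemma summand_sums_pole_pairs:
  "(\<lambda>t. summand (P ^ Suc t)) sums (\<Sum>i=e..n. \<Sum>j=0..n. wt1 i * wt2 j * pole_pair i j)"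
proof -
  have "(\<lambda>t. wt1 i * wt2 j * (P ^ Suc t / ((P ^ Suc t * P ^ i - 1) * (P ^ Suc t * P ^ j - 1))))
      sums (wt1 i * wt2 j * pole_pair i j)" for i j
    using double_pole_sums [OF P, of j] distinct_poles_sums [OF P, of i j]
    by (intro sums_mult) (auto simp: pole_pair_def power2_eq_square)
  then have "(\<lambda>t. \<Sum>i=e..n. \<Sum>j=0..n. wt1 i * wt2 j * (P ^ Suc t / ((P ^ Suc t * P ^ i - 1) * (P ^ Suc t * P ^ j - 1))))
      sums (\<Sum>i=e..n. \<Sum>j=0..n. wt1 i * wt2 j * pole_pair i j)"
    by (intro sums_sum)
  moreover have "summand (P ^ Suc t) = (\<Sum>i=e..n. \<Sum>j=0..n. wt1 i * wt2 j *
      (P ^ Suc t / ((P ^ Suc t * P ^ i - 1) * (P ^ Suc t * P ^ j - 1))))" for t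
  proof -
    define x where "x = P ^ Suc t"
    have ne: "x * P ^ k - 1 \<noteq> 0" for k
      using one_less_power [OF P, of "Suc t + k"] by (simp add: x_def power_add mult.assoc)
    have "summand x = x * ((1 / (\<Prod>i=e..n. x * P ^ i - 1)) * ((\<Prod>s=1..n. x - P ^ s) / (\<Prod>i=0..n. x * P ^ i - 1)))"
      by (simp add: summand_def)
    also have "\<dots> = x * ((\<Sum>i=e..n. wt1 i / (x * P ^ i - 1)) * (\<Sum>j=0..n. wt2 j / (x * P ^ j - 1)))"
      using ne by (simp add: wt1_partial_fractions wt2_partial_fractions del: One_nat_def)
    also have "\<dots> = (\<Sum>i=e..n. \<Sum>j=0..n. wt1 i * wt2 j * (x / ((x * P ^ i - 1) * (x * P ^ j - 1))))"
      by (simp add: sum_product sum_distrib_left mult_ac)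
    finally show ?thesis by (simp add: x_def)
  qed
  ultimately show ?thesis by simp
qed

text \<open>Grouping by harmonic sums rather than by pairs of poles is what keeps the powers
  of \<open>P\<close> in the denominator small: the off-diagonal terms separately have much larger ones.\<close>

lemma sum_pole_pairs:
  "(\<Sum>i=e..n. \<Sum>j=0..n. wt1 i * wt2 j * pole_pair i j) =
    (\<Sum>j=e..n. wt1 j * wt2 j / P ^ j * (zeta_q2 (1 / P) - harm2 P j - (logder1 j + logder2 j) * harm1 P j))
    - (\<Sum>j<e. wt2 j * single_pole_factor j / P ^ j * harm1 P j)"
proof -
  define h where "h = harm1 P"
  have "(\<Sum>j=0..n. wt1 i * wt2 j * pole_pair i j) = wt1 i * wt2 i / P ^ i * (zeta_q2 (1 / P) - harm2 P i)
      + (\<Sum>j\<in>{0..n} - {i}. wt1 i * wt2 j * pole_pair i j)" if "i \<in> {e..n}" for i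
    using that by (subst sum.remove [of _ i]) (auto simp: pole_pair_def)
  then have "(\<Sum>i=e..n. \<Sum>j=0..n. wt1 i * wt2 j * pole_pair i j) =
      (\<Sum>i=e..n. wt1 i * wt2 i / P ^ i * (zeta_q2 (1 / P) - harm2 P i)) +
      (\<Sum>i=e..n. \<Sum>j\<in>{0..n} - {i}. wt1 i * wt2 j * pole_pair i j)"
    by (simp add: sum.distrib)
  also have "(\<Sum>i=e..n. \<Sum>j\<in>{0..n} - {i}. wt1 i * wt2 j * pole_pair i j) =
      (\<Sum>i=e..n. \<Sum>j\<in>{0..n} - {i}. wt1 i * h i * (wt2 j / (P ^ i - P ^ j)))
      + (\<Sum>i=e..n. \<Sum>j\<in>{0..n} - {i}. wt2 j * h j * (wt1 i / (P ^ j - P ^ i)))"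
    unfolding sum.distrib [symmetric]
  proof (intro sum.cong refl)
    fix i j assume "j \<in> {0..n} - {i}"
    then have "P ^ i \<noteq> P ^ j" using P by (auto simp: power_inject_exp)
    then have "P ^ i - P ^ j \<noteq> 0" "P ^ j - P ^ i = - (P ^ i - P ^ j)" by auto
    then show "wt1 i * wt2 j * pole_pair i j =
        wt1 i * h i * (wt2 j / (P ^ i - P ^ j)) + wt2 j * h j * (wt1 i / (P ^ j - P ^ i))"
      using \<open>j \<in> {0..n} - {i}\<close> by (simp add: pole_pair_def h_def minus_divide_right [symmetric] del: minus_diff_eq)
        (simp add: divide_simps, simp add: algebra_simps)
  qed
  also have "(\<Sum>i=e..n. \<Sum>j\<in>{0..n} - {i}. wt1 i * h i * (wt2 j / (P ^ i - P ^ j))) =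
      (\<Sum>i=e..n. - (wt1 i * wt2 i / P ^ i * (logder2 i * h i)))"
    unfolding sum_distrib_left [symmetric] by (intro sum.cong refl) (simp add: wt2_regular_part)
  also have "(\<Sum>i=e..n. \<Sum>j\<in>{0..n} - {i}. wt2 j * h j * (wt1 i / (P ^ j - P ^ i))) =
      (\<Sum>j=0..n. \<Sum>i\<in>{e..n} - {j}. wt2 j * h j * (wt1 i / (P ^ j - P ^ i)))"
  proof -
    have "{0..n} - {i} = {j \<in> {0..n}. i \<noteq> j}" "{e..n} - {j} = {i \<in> {e..n}. i \<noteq> j}" for i j by auto
    then show ?thesis by (simp only: sum.swap_restrict [of "{e..n}" "{0..n}"] finite_atLeastAtMost)
  qed
  also have "\<dots> = (\<Sum>j=0..n. wt2 j * h j * (\<Sum>i\<in>{e..n} - {j}. wt1 i / (P ^ j - P ^ i)))"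
    by (simp add: sum_distrib_left)
  also have "\<dots> = (\<Sum>j<e. wt2 j * h j * (\<Sum>i\<in>{e..n} - {j}. wt1 i / (P ^ j - P ^ i))) +
      (\<Sum>j=e..n. wt2 j * h j * (\<Sum>i\<in>{e..n} - {j}. wt1 i / (P ^ j - P ^ i)))"
    using en by (subst sum.union_disjoint [symmetric]) (auto intro!: sum.cong)
  also have "(\<Sum>j<e. wt2 j * h j * (\<Sum>i\<in>{e..n} - {j}. wt1 i / (P ^ j - P ^ i))) =
      (\<Sum>j<e. - (wt2 j * single_pole_factor j / P ^ j * h j))"
    by (intro sum.cong refl) (simp add: wt1_regular_part_outside)
  also have "(\<Sum>j=e..n. wt2 j * h j * (\<Sum>i\<in>{e..n} - {j}. wt1 i / (P ^ j - P ^ i))) =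
      (\<Sum>j=e..n. - (wt1 j * wt2 j / P ^ j * (logder1 j * h j)))"
    by (intro sum.cong refl) (simp add: wt1_regular_part)
  finally show ?thesis
    unfolding h_def [symmetric]
    by (simp add: sum_negf sum.distrib sum_subtractf diff_divide_distrib add_divide_distrib algebra_simps)
qed

end

section \<open>Weights as quotients of q-factorials\<close>

definition qfact :: "real \<Rightarrow> nat \<Rightarrow> real" where
  "qfact P m = (\<Prod>s=1..m. P ^ s - 1)"

lemma qfact_pos: "P > 1 \<Longrightarrow> qfact P m > 0"
  unfolding qfact_def by (intro prod_pos) auto

lemma qfact_0 [simp]: "qfact P 0 = 1"
  by (simp add: qfact_def)

lemma qfact_Suc: "qfact P (Suc m) = qfact P m * (P ^ Suc m - 1)"
  by (simp add: qfact_def)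

lemma prod_shift_qfact:
  assumes "P > 1"
  shows "(\<Prod>s=1..m. P ^ (s + j) - 1) = qfact P (m + j) / qfact P j"
proof (induction m)
  case (Suc m)
  have "qfact P j \<noteq> 0" using qfact_pos [OF assms, of j] by simp
  then show ?case using Suc by (simp add: qfact_Suc)
qed (use qfact_pos [OF assms, of j] in simp)

lemma prod_pole_above:
  fixes P :: real
  assumes "P > 1"
  shows "(\<Prod>k\<in>{i<..i + m}. P ^ k / P ^ i - 1) = qfact P m"
proof -
  have "(\<Prod>k\<in>{i<..i + m}. P ^ k / P ^ i - 1) = (\<Prod>s=1..m. P ^ s - 1)"
    by (rule prod.reindex_bij_witness [where i = "\<lambda>s. s + i" and j = "\<lambda>k. k - i"])
       (use assms in \<open>auto simp: power_diff\<close>)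
  then show ?thesis by (simp add: qfact_def)
qed

lemma prod_pole_below:
  fixes P :: real
  assumes P: "P > 1"
  shows "(\<Prod>k\<in>{i..<i + m}. P ^ k / P ^ (i + m) - 1) = (-1) ^ m * qfact P m / P ^ (\<Sum>{1..m})"
proof -
  have "(\<Prod>k\<in>{i..<i + m}. P ^ k / P ^ (i + m) - 1) = (\<Prod>s=1..m. (- 1) * (P ^ s - 1) / P ^ s)"
  proof (rule prod.reindex_bij_witness [where i = "\<lambda>s. i + m - s" and j = "\<lambda>k. i + m - k"])
    fix k assume "k \<in> {i..<i + m}"
    then obtain d where d: "i + m = k + d" by (metis atLeastLessThan_iff le_add_diff_inverse less_imp_le)
    show "(- 1) * (P ^ (i + m - k) - 1) / P ^ (i + m - k) = P ^ k / P ^ (i + m) - 1"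
      unfolding d using P by (simp add: power_add field_simps)
  qed auto
  also have "\<dots> = (-1) ^ m * qfact P m / P ^ (\<Sum>{1..m})"
    unfolding prod_dividef prod.distrib by (simp add: qfact_def power_sum)
  finally show ?thesis .
qed

lemma prod_poles:
  fixes P :: real
  assumes P: "P > 1" and "e \<le> i" "i \<le> n"
  shows "(\<Prod>k\<in>{e..n} - {i}. P ^ k / P ^ i - 1) =
    (-1) ^ (i - e) * qfact P (i - e) * qfact P (n - i) / P ^ (\<Sum>{1..i - e})"
proof -
  have eq: "{e..n} - {i} = {e..<e + (i - e)} \<union> {i<..i + (n - i)}" using assms by auto
  have "(\<Prod>k\<in>{e..n} - {i}. P ^ k / P ^ i - 1) =
      (\<Prod>k\<in>{e..<e + (i - e)}. P ^ k / P ^ i - 1) * (\<Prod>k\<in>{i<..i + (n - i)}. P ^ k / P ^ i - 1)"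
    unfolding eq by (rule prod.union_disjoint) (use assms in auto)
  also have "(\<Prod>k\<in>{e..<e + (i - e)}. P ^ k / P ^ i - 1) = (-1) ^ (i - e) * qfact P (i - e) / P ^ (\<Sum>{1..i - e})"
    using prod_pole_below [OF P, of e "i - e"] assms by simp
  also have "(\<Prod>k\<in>{i<..i + (n - i)}. P ^ k / P ^ i - 1) = qfact P (n - i)"
    by (rule prod_pole_above [OF P])
  finally show ?thesis by simp
qed

lemma prod_zeros:
  fixes P :: real
  assumes P: "P > 1"
  shows "(\<Prod>s=1..n. 1 / P ^ j - P ^ s) = (-1) ^ n * qfact P (n + j) / (qfact P j * P ^ (n * j))"
proof -
  have "(\<Prod>s=1..n. 1 / P ^ j - P ^ s) = (\<Prod>s=1..n. (- 1) * (P ^ (s + j) - 1) / P ^ j)"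
    using P by (intro prod.cong refl) (simp add: field_simps power_add)
  also have "\<dots> = (-1) ^ n * (\<Prod>s=1..n. P ^ (s + j) - 1) / P ^ (n * j)"
    unfolding prod_dividef prod.distrib by (simp add: power_mult [symmetric] mult.commute)
  finally show ?thesis by (simp only: prod_shift_qfact [OF P]) simp
qed

lemma minus_one_power_cases: "(-1 :: real) ^ m = 1 \<or> (-1 :: real) ^ m = -1"
  by (simp add: minus_one_power_iff)

context linear_form
begin

lemma wt1_qfact:
  assumes "e \<le> i" "i \<le> n"
  shows "wt1 i = (-1) ^ (i - e) * P ^ (\<Sum>{1..i - e}) / (qfact P (i - e) * qfact P (n - i))"
  unfolding wt1_def prod_poles [OF P assms] using minus_one_power_cases [of "i - e"] by auto

lemma wt2_qfact:
  assumes "j \<le> n"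
  shows "wt2 j = (-1) ^ (n + j) * P ^ (\<Sum>{1..j}) * qfact P (n + j)
    / (P ^ (n * j) * (qfact P j)\<^sup>2 * qfact P (n - j))"
  unfolding wt2_def prod_zeros [OF P] prod_poles [OF P le0 \<open>j \<le> n\<close>] power_add
  using minus_one_power_cases [of j] by (auto simp: power2_eq_square mult_ac)

lemma single_pole_factor_qfact:
  assumes "j < e"
  shows "single_pole_factor j = qfact P (e - j - 1) / qfact P (n - j)"
proof -
  have eq: "{j<..j + (n - j)} = {j<..j + (e - j - 1)} \<union> {e..n}" using assms en by auto
  have "(\<Prod>k\<in>{j<..j + (n - j)}. P ^ k / P ^ j - 1) =
      (\<Prod>k\<in>{j<..j + (e - j - 1)}. P ^ k / P ^ j - 1) * (\<Prod>k\<in>{e..n}. P ^ k / P ^ j - 1)"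
    unfolding eq by (rule prod.union_disjoint) (use assms in auto)
  then have "qfact P (n - j) = qfact P (e - j - 1) * (\<Prod>k\<in>{e..n}. P ^ k / P ^ j - 1)"
    by (simp only: prod_pole_above [OF P])
  moreover have "qfact P (n - j) > 0" "qfact P (e - j - 1) > 0" using qfact_pos [OF P] by auto
  ultimately show ?thesis unfolding single_pole_factor_def
    by (metis divide_self_if mult_divide_mult_cancel_left mult_1_right order_less_irrefl)
qed

text \<open>The weights at a double pole without sign and power of P. The extra factor
  \<open>qfact P (n - e)\<close> makes this the product of the three q-binomial coefficients (n - e
  over j - e), (n + j over j) and (n over j).\<close>

definition core :: "nat \<Rightarrow> real" where
  "core j = qfact P (n - e) * qfact P (n + j) /
     (qfact P (j - e) * (qfact P (n - j))\<^sup>2 * (qfact P j)\<^sup>2)"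

text \<open>Two q-binomial coefficients as in \<open>core\<close>, divided by (n - j - 1 over e - j
  - 1) and by P ^ (n - j) - 1. This one need not be integral for integral P.\<close>

definition single_core :: "nat \<Rightarrow> real" where
  "single_core j = qfact P (n - e) * qfact P (n + j) * qfact P (e - j - 1) /
     ((qfact P (n - j))\<^sup>2 * (qfact P j)\<^sup>2)"

lemma wt_product_core:
  assumes "e \<le> j" "j \<le> n"
  shows "qfact P (n - e) * (wt1 j * wt2 j / P ^ j) =
    (-1) ^ (n + e) * P ^ (\<Sum>{1..j - e} + \<Sum>{1..j}) / P ^ (n * j + j) * core j"
proof -
  have "(-1 :: real) ^ (j - e) * (-1) ^ (n + j) = (-1) ^ (n + e)"
    using assms by (simp add: power_add [symmetric] minus_one_power_iff)
  then have "(-1) ^ (n + e) = (-1 :: real) ^ (j - e) * (-1) ^ (n + j)" by simp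
  then show ?thesis
    unfolding wt1_qfact [OF assms] wt2_qfact [OF assms(2)] core_def power_add [of P]
    by (simp only: divide_inverse inverse_mult_distrib power2_eq_square mult_ac)
qed

lemma wt2_single_core:
  assumes "j < e"
  shows "qfact P (n - e) * (wt2 j * single_pole_factor j / P ^ j) =
    (-1) ^ (n + j) * P ^ (\<Sum>{1..j}) / P ^ (n * j + j) * single_core j"
proof -
  have "j \<le> n" using assms en by simp
  then show ?thesis
    unfolding single_pole_factor_qfact [OF assms] single_core_def wt2_qfact [OF \<open>j \<le> n\<close>] power_add [of P]
    by (simp only: divide_inverse inverse_mult_distrib power2_eq_square mult_ac)
qed

end

section \<open>Denominators\<close>

text \<open>Every factor of the linear forms is a product of powers of \<open>cyc p k\<close>.
  Recording the exponents as a function on a common range turns integrality into an inequality of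
  exponents for each k, without any coprimality.\<close>

definition cyc_prod :: "nat \<Rightarrow> nat \<Rightarrow> (nat \<Rightarrow> nat) \<Rightarrow> nat" where
  "cyc_prod p U f = (\<Prod>k=1..U. cyc p k ^ f k)"

lemma cyc_prod_pos: "cyc_prod p U f > 0"
  unfolding cyc_prod_def by (intro prod_pos) (simp add: cyc_pos)

lemma cyc_prod_add: "cyc_prod p U (\<lambda>k. f k + g k) = cyc_prod p U f * cyc_prod p U g"
  by (simp add: cyc_prod_def power_add prod.distrib)

lemma cyc_prod_dvd:
  assumes "\<And>k. k \<in> {1..U} \<Longrightarrow> f k \<le> g k"
  shows "cyc_prod p U f dvd cyc_prod p U g"
  unfolding cyc_prod_def using assms by (intro prod_dvd_prod le_imp_power_dvd) auto

lemma cyc_prod_quotient_Ints: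
  assumes "\<And>k. k \<in> {1..U} \<Longrightarrow> f k \<le> g k"
  shows "real (cyc_prod p U g) / real (cyc_prod p U f) \<in> \<int>"
proof -
  have "cyc_prod p U f dvd cyc_prod p U g" using assms by (rule cyc_prod_dvd)
  then obtain c where "cyc_prod p U g = cyc_prod p U f * c" by (elim dvdE)
  then show ?thesis using cyc_prod_pos [of p U f] by simp
qed

lemma power_minus_one_cyc_prod:
  assumes "p \<ge> 2" "1 \<le> s" "s \<le> U"
  shows "real p ^ s - 1 = real (cyc_prod p U (\<lambda>k. of_bool (k dvd s)))"
proof -
  have "{k. k dvd s} \<subseteq> {1..U}"
    using assms by (auto simp: Suc_le_eq intro: dvd_pos_nat order_trans [OF dvd_imp_le])
  then have "cyc_prod p U (\<lambda>k. of_bool (k dvd s)) = (\<Prod>k | k dvd s. cyc p k)"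
    unfolding cyc_prod_def by (intro prod.mono_neutral_cong_right) auto
  also have "\<dots> = p ^ s - 1" by (rule prod_cyc) (use assms in auto)
  finally show ?thesis using assms by (simp add: of_nat_diff)
qed

text \<open>The q-analogue of Legendre's formula: \<open>cyc p k\<close> enters once for each
  multiple of k up to m.\<close>

lemma qfact_cyc_prod:
  assumes "p \<ge> 2" "m \<le> U"
  shows "qfact (real p) m = real (cyc_prod p U (\<lambda>k. m div k))"
  using assms(2)
proof (induction m)
  case (Suc m)
  have "qfact (real p) (Suc m) = real (cyc_prod p U (\<lambda>k. m div k)) * real (cyc_prod p U (\<lambda>k. of_bool (k dvd Suc m)))"
    using Suc power_minus_one_cyc_prod [OF assms(1), of "Suc m" U] by (simp add: qfact_Suc)
  also have "\<dots> = real (cyc_prod p U (\<lambda>k. m div k + of_bool (k dvd Suc m)))"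
    by (simp add: cyc_prod_add)
  also have "(\<lambda>k. m div k + of_bool (k dvd Suc m)) = (\<lambda>k. Suc m div k)"
    by (auto simp: fun_eq_iff div_Suc dvd_eq_mod_eq_0)
  finally show ?case .
qed (simp add: cyc_prod_def)

section \<open>Comparison of exponents\<close>

lemma div_add_le: "a div k + b div k \<le> (a + b) div (k :: nat)"
  by (subst div_add1_eq) simp

lemma Suc_add_div_le: "Suc (a + b) div k \<le> a div k + b div k + (1 :: nat)"
proof (cases "k = 0")
  case False
  have "Suc (x * k + r + (y * k + s)) < (x + y + 2) * k" if "r < k" "s < k" for x y r s :: nat
    using that by (simp add: algebra_simps)
  from this [of "a mod k" "b mod k" "a div k" "b div k"] False
  have "Suc (a + b) < (a div k + b div k + 2) * k" by (simp add: mod_less_divisor)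
  then have "Suc (a + b) div k < a div k + b div k + 2" by (rule less_mult_imp_div_less)
  then show ?thesis by simp
qed simp

text \<open>The cyclotomic factors that are needed only once, instead of twice, in the common
  denominator. The bound 8 is the largest one for which \<open>2 * N < k\<close> holds for all saved \<open>k\<close>.\<close>

definition saved :: "nat \<Rightarrow> nat \<Rightarrow> bool" where
  "saved N k \<longleftrightarrow> (\<exists>m\<in>{2..8}. 16 * N < m * k \<and> m * k \<le> 17 * N)"

text \<open>Two factors per k are the normal price, since harmonic sums and logarithmic derivatives
  bring divisors (p ^ s - 1) * (p ^ l - 1). For k > 16 N nothing is needed: k divides no l <= 16 N,
  and if k divides s <= 16 N + j, then \<open>core j\<close> already contains the factor.\<close>

definition cyc_exp :: "nat \<Rightarrow> nat \<Rightarrow> nat" where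
  "cyc_exp N k = (if k > 16 * N then 0 else if saved N k then 1 else 2)"

lemma saved_gt: "saved N k \<Longrightarrow> 2 * N < k"
proof -
  assume "saved N k"
  then obtain m where "m \<le> 8" "16 * N < m * k" by (auto simp: saved_def)
  then have "16 * N < 8 * k" using mult_le_mono1 [of m 8 k] by linarith
  then show ?thesis by simp
qed

text \<open>Exponent by exponent, the integrality of the three q-binomial coefficients in
  \<open>core\<close>.\<close>

lemma core_exponent:
  fixes N j k :: nat
  assumes "N \<le> j" "j \<le> 16 * N"
  shows "(j - N) div k + (16 * N - j) div k \<le> (15 * N) div k"
    and "j div k + (16 * N - j) div k \<le> 16 * N div k"
    and "16 * N div k + j div k \<le> (16 * N + j) div k"
proof -
  have "j - N + (16 * N - j) = 15 * N" "j + (16 * N - j) = 16 * N" using assms by auto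
  then show "(j - N) div k + (16 * N - j) div k \<le> (15 * N) div k"
    and "j div k + (16 * N - j) div k \<le> 16 * N div k"
    using div_add_le [of "j - N" k "16 * N - j"] div_add_le [of j k "16 * N - j"] by (simp_all only:)
qed (rule div_add_le)

text \<open>For a saved \<open>k\<close> the residue of \<open>16 N\<close> modulo \<open>k\<close> is at least \<open>k - N\<close>, so for each
  residue of \<open>j\<close> there is a carry either in \<open>16 N + j\<close> or in \<open>(j - N) + (16 N - j)\<close>.\<close>

lemma core_exponent_saved:
  assumes sv: "saved N k" and j: "N \<le> j" "j \<le> 16 * N"
  shows "(j - N) div k + 2 * ((16 * N - j) div k) + 2 * (j div k) + 1 \<le> (15 * N) div k + (16 * N + j) div k"
proof -
  obtain m where m: "2 \<le> m" "16 * N < m * k" "m * k \<le> 17 * N"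
    using sv by (auto simp: saved_def)
  obtain m' where m': "m = Suc m'" using m by (cases m) auto
  have k: "2 * N < k" using sv by (rule saved_gt)
  define r where "r = 16 * N - m' * k"
  have r: "16 * N = m' * k + r" using m k by (simp add: m' r_def)
  have rk: "r < k" "k \<le> r + N" "N \<le> r" using m k r by (auto simp: m')
  define a t where "a = j div k" and "t = j mod k"
  have jat: "j = a * k + t" "t < k" using k by (auto simp: a_def t_def)
  have n_div: "16 * N div k = m'" unfolding r using rk by simp
  \<comment> \<open>As r >= N, passing from 16 N down to 15 N crosses no multiple of k.\<close>
  have e_div: "15 * N div k = m'"
  proof -
    have "k * m' \<le> 15 * N" "15 * N < k * Suc m'" using r rk by (simp_all add: mult.commute)
    then show ?thesis by (rule div_nat_eqI)
  qed
  show ?thesis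
  proof (cases "t + r < k")
    case False
    have "(16 * N + j) div k \<ge> m' + a + 1"
    proof -
      have "16 * N + j = (m' + a) * k + (t + r)" using r jat by (simp add: algebra_simps)
      then have "(16 * N + j) div k = m' + a + (t + r) div k" using k by simp
      moreover have "(t + r) div k \<ge> 1" using False k by (simp add: Suc_le_eq div_greater_zero_iff)
      ultimately show ?thesis by simp
    qed
    then show ?thesis using core_exponent [OF j, of k] n_div by (simp add: a_def)
  next
    case True
    \<comment> \<open>Without a carry in 16 N + j, the residue t of j lies below N, so subtracting N
      borrows: the quotient of j - N is below a, that of 16 N - j is at most m' - a, and together
      they miss the quotient m' of 15 N by at least one.\<close>
    then have tN: "t < N" using rk by linarith
    have "1 \<le> a" using jat tN j by (cases a) auto
    then obtain a' where a': "a = Suc a'" by (cases a) auto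
    have "j - N < a * k" using jat tN j by linarith
    then have 1: "(j - N) div k < a" by (rule less_mult_imp_div_less)
    have am: "a \<le> m'"
    proof -
      have "a * k \<le> 16 * N" using jat j by linarith
      then have "a * k < m * k" using m by linarith
      then have "a < m" by simp
      then show ?thesis by (simp add: m')
    qed
    obtain d where d: "m' = a + d" using am le_Suc_ex by blast
    have "16 * N - j < (d + 1) * k"
      using r jat rk by (simp add: d algebra_simps)
    then have "16 * N - j < (m' - a + 1) * k" by (simp add: d)
    then have 2: "(16 * N - j) div k < m' - a + 1" by (rule less_mult_imp_div_less)
    show ?thesis using core_exponent [OF j, of k] n_div e_div 1 2 am by (simp add: a_def)
  qed
qed

lemma core_exponent_two:
  assumes j: "N \<le> j" "j \<le> 16 * N" and k: "k \<le> 16 * N"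
  shows "(j - N) div k + 2 * ((16 * N - j) div k) + 2 * (j div k) + 2
    \<le> cyc_exp N k + (15 * N) div k + (16 * N + j) div k"
proof (cases "saved N k")
  case True
  then have "cyc_exp N k = 1" using k by (simp add: cyc_exp_def)
  then show ?thesis using core_exponent_saved [OF True j] by linarith
next
  case False
  then have "cyc_exp N k = 2" using k by (simp add: cyc_exp_def)
  then show ?thesis using core_exponent [OF j, of k] by linarith
qed

text \<open>Since 16 N - j is the successor of 15 N + (N - j - 1), at most one carry is lost, and
  one unit of \<open>cyc_exp\<close> pays for it. The divisor p ^ l - 1 needs a second unit only if
  k dvd l; for saved k, where there is none, k > 2 N > l excludes this.\<close>

lemma single_core_exponent:
  assumes j: "j < N" and "l \<le> j" "1 \<le> l"
  shows "2 * ((16 * N - j) div k) + 2 * (j div k) + of_bool (k dvd l)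
    \<le> cyc_exp N k + (15 * N) div k + (16 * N + j) div k + (N - j - 1) div k"
proof (cases "k > 16 * N")
  case True
  then have "\<not> k dvd l" using assms by (auto dest: dvd_imp_le)
  then show ?thesis using True assms by simp
next
  case False
  have "16 * N - j = Suc (15 * N + (N - j - 1))" using assms by simp
  then have 1: "(16 * N - j) div k \<le> 15 * N div k + (N - j - 1) div k + 1"
    by (simp only: Suc_add_div_le)
  have 2: "j div k + (16 * N - j) div k \<le> 16 * N div k"
    using div_add_le [of j k "16 * N - j"] assms by simp
  have 3: "16 * N div k + j div k \<le> (16 * N + j) div k" by (rule div_add_le)
  have 4: "1 + of_bool (k dvd l) \<le> cyc_exp N k"
    using False saved_gt [of N k] assms by (auto simp: cyc_exp_def dest: dvd_imp_le)
  show ?thesis using 1 2 3 4 by linarith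
qed

section \<open>Integrality of the coefficients\<close>

locale approximants =
  fixes p N :: nat
  assumes p2: "p \<ge> 2" and N1: "N \<ge> 1"

sublocale approximants \<subseteq> linear_form "real p" N "16 * N"
  using p2 by unfold_locales auto

context approximants
begin

definition denom :: real where
  "denom = real (cyc_prod p (32 * N) (cyc_exp N))"

lemma core_quotient_Ints:
  assumes j: "N \<le> j" "j \<le> 16 * N"
    and X: "\<And>k. k \<in> {1..32 * N} \<Longrightarrow>
      (j - N) div k + 2 * ((16 * N - j) div k) + 2 * (j div k) + X k \<le> cyc_exp N k + (15 * N) div k + (16 * N + j) div k"
  shows "denom * core j / real (cyc_prod p (32 * N) X) \<in> \<int>"
proof -
  define C where "C = cyc_prod p (32 * N)"
  have eqs: "qfact (real p) (16 * N - N) = real (C (\<lambda>k. 15 * N div k))"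
    "qfact (real p) (16 * N + j) = real (C (\<lambda>k. (16 * N + j) div k))"
    "qfact (real p) (j - N) = real (C (\<lambda>k. (j - N) div k))"
    "qfact (real p) (16 * N - j) = real (C (\<lambda>k. (16 * N - j) div k))"
    "qfact (real p) j = real (C (\<lambda>k. j div k))"
    unfolding C_def using j p2 by (simp_all add: qfact_cyc_prod [of _ _ "32 * N"])
  have "denom * core j / real (C X) =
      real (C (\<lambda>k. cyc_exp N k + 15 * N div k + (16 * N + j) div k)) /
      real (C (\<lambda>k. (j - N) div k + 2 * ((16 * N - j) div k) + 2 * (j div k) + X k))"
    unfolding core_def eqs denom_def C_def [symmetric]
    by (simp add: C_def cyc_prod_add mult_2 power2_eq_square mult_ac)
  also have "\<dots> \<in> \<int>"
    unfolding C_def using X by (rule cyc_prod_quotient_Ints)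
  finally show ?thesis by (simp add: C_def)
qed

text \<open>The range of s reaches 16 N + j because the zeros of the summand put 1 - p ^ (s + j)
  into the logarithmic derivative; all other divisors have index at most 16 N.\<close>

lemma core_pair_Ints:
  assumes j: "N \<le> j" "j \<le> 16 * N" and l: "l \<in> {1..16 * N}" and s: "s \<in> {1..16 * N + j}"
  shows "denom * core j / ((real p ^ s - 1) * (real p ^ l - 1)) \<in> \<int>"
proof -
  have "(real p ^ s - 1) * (real p ^ l - 1) =
      real (cyc_prod p (32 * N) (\<lambda>k. of_bool (k dvd s) + of_bool (k dvd l)))"
    using power_minus_one_cyc_prod [OF p2, of s "32 * N"] power_minus_one_cyc_prod [OF p2, of l "32 * N"] j l s
    by (simp add: cyc_prod_add)
  also have "denom * core j / \<dots> \<in> \<int>"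
  proof (rule core_quotient_Ints [OF j])
    fix k assume k: "k \<in> {1..32 * N}"
    show "(j - N) div k + 2 * ((16 * N - j) div k) + 2 * (j div k) + (of_bool (k dvd s) + of_bool (k dvd l))
      \<le> cyc_exp N k + (15 * N) div k + (16 * N + j) div k"
    proof (cases "k \<le> 16 * N")
      case True
      have "of_bool (k dvd s) + of_bool (k dvd l) \<le> (2 :: nat)" by simp
      then show ?thesis using core_exponent_two [OF j True] by linarith
    next
      case False
      have "\<not> k dvd l" using False l by (auto dest: dvd_imp_le)
      moreover have "of_bool (k dvd s) \<le> (16 * N + j) div k"
        using k s by (auto simp: Suc_le_eq div_greater_zero_iff dest: dvd_imp_le)
      ultimately show ?thesis using False j by simp
    qed
  qed
  finally show ?thesis .
qed

lemma core_Ints: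
  assumes "N \<le> j" "j \<le> 16 * N"
  shows "denom * core j \<in> \<int>"
proof -
  have "denom * core j / real (cyc_prod p (32 * N) (\<lambda>k. 0)) \<in> \<int>"
  proof (rule core_quotient_Ints [OF assms])
    fix k
    show "(j - N) div k + 2 * ((16 * N - j) div k) + 2 * (j div k) + 0
      \<le> cyc_exp N k + (15 * N) div k + (16 * N + j) div k"
      using core_exponent [OF assms, of k] by linarith
  qed
  then show ?thesis by (simp add: cyc_prod_def)
qed

lemma single_core_Ints:
  assumes j: "j < N" and l: "l \<in> {1..j}"
  shows "denom * single_core j / (real p ^ l - 1) \<in> \<int>"
proof -
  define C where "C = cyc_prod p (32 * N)"
  have eqs: "qfact (real p) (16 * N - N) = real (C (\<lambda>k. 15 * N div k))"
    "qfact (real p) (16 * N + j) = real (C (\<lambda>k. (16 * N + j) div k))"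
    "qfact (real p) (N - j - 1) = real (C (\<lambda>k. (N - j - 1) div k))"
    "qfact (real p) (16 * N - j) = real (C (\<lambda>k. (16 * N - j) div k))"
    "qfact (real p) j = real (C (\<lambda>k. j div k))"
    "real p ^ l - 1 = real (C (\<lambda>k. of_bool (k dvd l)))"
    unfolding C_def using j l p2 by (simp_all add: qfact_cyc_prod [of _ _ "32 * N"] power_minus_one_cyc_prod [of _ _ "32 * N"])
  have "denom * single_core j / (real p ^ l - 1) =
      real (C (\<lambda>k. cyc_exp N k + 15 * N div k + (16 * N + j) div k + (N - j - 1) div k)) /
      real (C (\<lambda>k. 2 * ((16 * N - j) div k) + 2 * (j div k) + of_bool (k dvd l)))"
    unfolding single_core_def eqs denom_def C_def [symmetric]
    by (simp add: C_def cyc_prod_add mult_2 power2_eq_square mult_ac)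
  also have "\<dots> \<in> \<int>"
    unfolding C_def using single_core_exponent [OF j] l by (intro cyc_prod_quotient_Ints) auto
  finally show ?thesis .
qed

lemma core_harm1_Ints:
  assumes "\<And>l. l \<in> {1..j} \<Longrightarrow> c * y / (real p ^ l - 1) \<in> \<int>"
  shows "c * (y * harm1 (real p) j) \<in> \<int>"
proof -
  have "c * (y * harm1 (real p) j) = (\<Sum>l=1..j. c * y / (real p ^ l - 1))"
    by (simp add: harm1_def sum_distrib_left mult_ac)
  also have "\<dots> \<in> \<int>" using assms by (intro Ints_sum) auto
  finally show ?thesis .
qed

lemma core_harm2_Ints:
  assumes j: "N \<le> j" "j \<le> 16 * N"
  shows "denom * core j * harm2 (real p) j \<in> \<int>"
proof -
  have "denom * core j * harm2 (real p) j =
      (\<Sum>l=1..j. real p ^ l * (denom * core j / ((real p ^ l - 1) * (real p ^ l - 1))))"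
    by (simp add: harm2_def sum_distrib_left power2_eq_square mult_ac)
  also have "\<dots> \<in> \<int>"
    using j by (intro Ints_sum Ints_mult core_pair_Ints) (auto intro: Ints_power)
  finally show ?thesis .
qed

lemma pole_ratio_cases:
  assumes "k \<noteq> j" "k \<le> 16 * N" "j \<le> 16 * N"
  shows "\<exists>z\<in>\<int>. \<exists>s\<in>{1..16 * N}. (real p ^ k / real p ^ j) / (real p ^ k / real p ^ j - 1) = z / (real p ^ s - 1)"
proof (cases "k > j")
  case True
  then obtain d where d: "k = j + d" "d \<ge> 1" by (metis Suc_leI less_imp_add_positive One_nat_def)
  have "(real p ^ k / real p ^ j) / (real p ^ k / real p ^ j - 1) = real p ^ d / (real p ^ d - 1)"
    using P by (simp add: d power_add)
  then show ?thesis using d assms by (intro bexI [of _ "real p ^ d"] bexI [of _ d]) (auto intro: Ints_power)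
next
  case False
  with assms obtain d where d: "j = k + d" "d \<ge> 1"
    by (metis Suc_leI less_imp_add_positive One_nat_def linorder_neqE_nat)
  have "real p ^ d \<noteq> 1" using one_less_power [OF P, of d] d by simp
  then have "(real p ^ k / real p ^ j) / (real p ^ k / real p ^ j - 1) = - 1 / (real p ^ d - 1)"
    using P by (simp add: d power_add divide_simps)
  then show ?thesis using d assms by (intro bexI [of _ "- 1"] bexI [of _ d]) auto
qed

lemma core_logder_Ints:
  assumes j: "N \<le> j" "j \<le> 16 * N"
  shows "denom * core j * ((logder1 j + logder2 j) * harm1 (real p) j) \<in> \<int>"
proof (rule core_harm1_Ints)
  fix l assume "l \<in> {1..j}"
  then have l: "l \<in> {1..16 * N}" using j by auto
  define f where "f y = denom * core j * y / (real p ^ l - 1)" for y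
  have f_frac: "f (z / (real p ^ s - 1)) \<in> \<int>" if "s \<in> {1..16 * N + j}" "z \<in> \<int>" for s z
  proof -
    have "f (z / (real p ^ s - 1)) = z * (denom * core j / ((real p ^ s - 1) * (real p ^ l - 1)))"
      by (simp add: f_def mult_ac)
    then show ?thesis using core_pair_Ints [OF j l that(1)] that(2) by (simp only: Ints_mult)
  qed
  have f_pole: "f ((real p ^ k / real p ^ j) / (real p ^ k / real p ^ j - 1)) \<in> \<int>"
    if kj: "k \<noteq> j" and kn: "k \<le> 16 * N" for k
  proof -
    obtain z s where "z \<in> \<int>" "s \<in> {1..16 * N}"
      and eq: "(real p ^ k / real p ^ j) / (real p ^ k / real p ^ j - 1) = z / (real p ^ s - 1)"
      using pole_ratio_cases [OF kj kn j(2)] by blast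
    then show ?thesis unfolding eq by (intro f_frac) auto
  qed
  have f_zero: "f (1 / (1 - real p ^ (s + j))) \<in> \<int>" if "s \<in> {1..16 * N}" for s
  proof -
    have "1 / (1 - real p ^ (s + j)) = (- 1) / (real p ^ (s + j) - 1)"
      by (simp add: minus_divide_left [symmetric] minus_divide_right)
    then show ?thesis using that by (simp only:) (intro f_frac, auto)
  qed
  have "f (logder1 j + logder2 j) =
      - (\<Sum>k\<in>{N..16 * N} - {j}. f ((real p ^ k / real p ^ j) / (real p ^ k / real p ^ j - 1)))
      + ((\<Sum>s=1..16 * N. f (1 / (1 - real p ^ (s + j))))
        - (\<Sum>k\<in>{0..16 * N} - {j}. f ((real p ^ k / real p ^ j) / (real p ^ k / real p ^ j - 1))))"
    unfolding logder1_def logder2_def f_def sum_divide_distrib [symmetric] sum_distrib_left [symmetric]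
    by (simp only: distrib_left right_diff_distrib mult_minus_right add_divide_distrib diff_divide_distrib minus_divide_left)
  also have "\<dots> \<in> \<int>"
    by (intro Ints_add Ints_diff Ints_minus Ints_sum f_pole f_zero) auto
  finally show "denom * core j * (logder1 j + logder2 j) / (real p ^ l - 1) \<in> \<int>"
    unfolding f_def .
qed

text \<open>The power of \<open>p\<close> clears the negative powers of \<open>p\<close> in the products of weights, whose
  exponent \<open>j\<^sup>2 - 17 N j + (N\<^sup>2 - N) / 2\<close> is smallest at \<open>j = 17 N / 2\<close>.\<close>

definition scale :: real where
  "scale = real p ^ (72 * N\<^sup>2 + N) * denom * qfact (real p) (15 * N)"

lemma two_sum_Icc: "2 * \<Sum>{1..m} = m * (m + 1)" for m :: nat
  by (induction m) auto

lemma scale_exponent: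
  assumes j: "N \<le> j"
  shows "16 * N * j + j \<le> 72 * N\<^sup>2 + N + (\<Sum>{1..j - N} + \<Sum>{1..j})"
proof -
  obtain d where d: "j = N + d" using j le_Suc_ex by blast
  \<comment> \<open>The square vanishes at d = 15 N / 2, that is j = 17 N / 2, where the exponent is
    - (287/4) N^2 - N / 2; the 72 in \<open>scale\<close> is 287/4 rounded up.\<close>
  have "0 \<le> (2 * int d - 15 * int N)\<^sup>2" by simp
  then have "60 * (int N * int d) \<le> 4 * (int d)\<^sup>2 + 225 * (int N)\<^sup>2"
    by (simp add: power2_eq_square algebra_simps)
  then have "int (60 * (N * d)) \<le> int (4 * d\<^sup>2 + 225 * N\<^sup>2)" by simp
  then have "60 * (N * d) \<le> 4 * d\<^sup>2 + 225 * N\<^sup>2" by (simp only: of_nat_le_iff)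
  then have "2 * (16 * N * j + j) \<le> 2 * (72 * N\<^sup>2 + N) + ((j - N) * (j - N + 1) + j * (j + 1))"
    by (simp add: d power2_eq_square algebra_simps)
  also have "\<dots> = 2 * (72 * N\<^sup>2 + N + (\<Sum>{1..j - N} + \<Sum>{1..j}))"
    unfolding two_sum_Icc [symmetric] by (simp only: distrib_left)
  finally show ?thesis by (rule mult_left_le_imp_le) simp
qed

lemma scale_wt_product:
  assumes j: "N \<le> j" "j \<le> 16 * N"
  shows "\<exists>z\<in>\<int>. scale * (wt1 j * wt2 j / real p ^ j) = z * (denom * core j)"
proof -
  define x where "x = 72 * N\<^sup>2 + N + (\<Sum>{1..j - N} + \<Sum>{1..j})"
  define y where "y = 16 * N * j + j"
  have xy: "real p ^ x / real p ^ y = real p ^ (x - y)"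
    using scale_exponent [OF j(1)] P by (simp add: x_def y_def power_diff)
  have "scale * (wt1 j * wt2 j / real p ^ j) =
      real p ^ (72 * N\<^sup>2 + N) * denom * (qfact (real p) (16 * N - N) * (wt1 j * wt2 j / real p ^ j))"
    by (simp add: scale_def)
  also have "\<dots> = (-1) ^ (16 * N + N) * (real p ^ x / real p ^ y) * (denom * core j)"
    unfolding wt_product_core [OF j] x_def y_def power_add [of "real p" "72 * N\<^sup>2 + N"] by (simp only: divide_inverse mult_ac)
  finally show ?thesis unfolding xy by (rule bexI) (auto intro!: Ints_mult Ints_power)
qed

lemma scale_single:
  assumes j: "j < N"
  shows "\<exists>z\<in>\<int>. scale * (wt2 j * single_pole_factor j / real p ^ j) = z * (denom * single_core j)"
proof -
  define x where "x = 72 * N\<^sup>2 + N + \<Sum>{1..j}"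
  define y where "y = 16 * N * j + j"
  have "16 * N * j \<le> 72 * N\<^sup>2" using j by (simp add: power2_eq_square mult_le_mono)
  then have xy: "real p ^ x / real p ^ y = real p ^ (x - y)"
    using j P by (simp add: x_def y_def power_diff)
  have "scale * (wt2 j * single_pole_factor j / real p ^ j) =
      real p ^ (72 * N\<^sup>2 + N) * denom * (qfact (real p) (16 * N - N) * (wt2 j * single_pole_factor j / real p ^ j))"
    by (simp add: scale_def)
  also have "\<dots> = (-1) ^ (16 * N + j) * (real p ^ x / real p ^ y) * (denom * single_core j)"
    unfolding wt2_single_core [OF j] x_def y_def power_add [of "real p" "72 * N\<^sup>2 + N"] by (simp only: divide_inverse mult_ac)
  finally show ?thesis unfolding xy by (rule bexI) (auto intro!: Ints_mult Ints_power)
qed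

definition coeff_zeta :: real where
  "coeff_zeta = scale * (\<Sum>j=N..16 * N. wt1 j * wt2 j / real p ^ j)"

definition coeff_const :: real where
  "coeff_const = scale * ((\<Sum>j=N..16 * N. wt1 j * wt2 j / real p ^ j *
       (harm2 (real p) j + (logder1 j + logder2 j) * harm1 (real p) j))
     + (\<Sum>j<N. wt2 j * single_pole_factor j / real p ^ j * harm1 (real p) j))"

lemma summand_sums_linear_form:
  "(\<lambda>t. scale * summand (real p ^ Suc t)) sums (coeff_zeta * zeta_q2 (1 / real p) - coeff_const)"
proof -
  have "(\<Sum>j=N..16 * N. wt1 j * wt2 j / real p ^ j * (zeta_q2 (1 / real p) - harm2 (real p) j - (logder1 j + logder2 j) * harm1 (real p) j))
    = (\<Sum>j=N..16 * N. wt1 j * wt2 j / real p ^ j) * zeta_q2 (1 / real p)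
      - (\<Sum>j=N..16 * N. wt1 j * wt2 j / real p ^ j * (harm2 (real p) j + (logder1 j + logder2 j) * harm1 (real p) j))"
    unfolding sum_distrib_right sum_subtractf [symmetric] by (intro sum.cong refl) (simp only: right_diff_distrib distrib_left diff_diff_eq)
  then have "scale * ((\<Sum>j=N..16 * N. wt1 j * wt2 j / real p ^ j * (zeta_q2 (1 / real p) - harm2 (real p) j - (logder1 j + logder2 j) * harm1 (real p) j))
    - (\<Sum>j<N. wt2 j * single_pole_factor j / real p ^ j * harm1 (real p) j)) = coeff_zeta * zeta_q2 (1 / real p) - coeff_const"
    unfolding coeff_zeta_def coeff_const_def by (simp only: right_diff_distrib distrib_left diff_diff_eq mult.assoc)
  moreover have "(\<lambda>t. scale * summand (real p ^ Suc t)) sums (scale * ((\<Sum>j=N..16 * N. wt1 j * wt2 j / real p ^ j * (zeta_q2 (1 / real p) - harm2 (real p) j - (logder1 j + logder2 j) * harm1 (real p) j))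
    - (\<Sum>j<N. wt2 j * single_pole_factor j / real p ^ j * harm1 (real p) j)))"
    using summand_sums_pole_pairs unfolding sum_pole_pairs by (rule sums_mult)
  ultimately show ?thesis by simp
qed

lemma coeff_zeta_Ints: "coeff_zeta \<in> \<int>"
  unfolding coeff_zeta_def sum_distrib_left
proof (rule Ints_sum)
  fix j assume "j \<in> {N..16 * N}"
  then have j: "N \<le> j" "j \<le> 16 * N" by auto
  then obtain z where "z \<in> \<int>" "scale * (wt1 j * wt2 j / real p ^ j) = z * (denom * core j)"
    using scale_wt_product by blast
  then show "scale * (wt1 j * wt2 j / real p ^ j) \<in> \<int>" using core_Ints [OF j] by simp
qed

lemma coeff_const_Ints: "coeff_const \<in> \<int>"
  unfolding coeff_const_def distrib_left [of scale] sum_distrib_left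
proof (intro Ints_add Ints_sum)
  fix j assume "j \<in> {N..16 * N}"
  then have j: "N \<le> j" "j \<le> 16 * N" by auto
  then obtain z where z: "z \<in> \<int>" "scale * (wt1 j * wt2 j / real p ^ j) = z * (denom * core j)"
    using scale_wt_product by blast
  have "scale * (wt1 j * wt2 j / real p ^ j * (harm2 (real p) j + (logder1 j + logder2 j) * harm1 (real p) j)) =
      z * (denom * core j * harm2 (real p) j + denom * core j * ((logder1 j + logder2 j) * harm1 (real p) j))"
    using z(2) by (simp only: mult.assoc [symmetric] distrib_left)
  also have "\<dots> \<in> \<int>"
    by (rule Ints_mult [OF z(1) Ints_add [OF core_harm2_Ints [OF j] core_logder_Ints [OF j]]])
  finally show "scale * (wt1 j * wt2 j / real p ^ j * (harm2 (real p) j + (logder1 j + logder2 j) * harm1 (real p) j)) \<in> \<int>" .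
next
  fix j assume "j \<in> {..<N}"
  then have j: "j < N" by auto
  then obtain z where z: "z \<in> \<int>" "scale * (wt2 j * single_pole_factor j / real p ^ j) = z * (denom * single_core j)"
    using scale_single by blast
  have "denom * single_core j * (1 * harm1 (real p) j) \<in> \<int>"
    using single_core_Ints [OF j] by (intro core_harm1_Ints) simp
  then have "z * (denom * single_core j * harm1 (real p) j) \<in> \<int>" using z(1) by simp
  also have "z * (denom * single_core j * harm1 (real p) j) =
      scale * (wt2 j * single_pole_factor j / real p ^ j * harm1 (real p) j)"
    using z(2) by (simp only: mult.assoc [symmetric])
  finally show "scale * (wt2 j * single_pole_factor j / real p ^ j * harm1 (real p) j) \<in> \<int>" .
qed

end

section \<open>Size of the linear forms\<close>

lemma qfact_bounds:
  assumes "P \<ge> 2"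
  shows "exp (ln P * (real m * (real m - 1) / 2)) \<le> qfact P m"
    and "qfact P m \<le> exp (ln P * (real m * (real m + 1) / 2))"
proof (induction m)
  case (Suc m)
  have ge: "1 \<le> P ^ m" using assms by (intro one_le_power) auto
  have "P ^ m + 1 \<le> 2 * P ^ m" using ge by simp
  also have "\<dots> \<le> P ^ Suc m" using assms by simp
  finally have low: "P ^ m \<le> P ^ Suc m - 1" by simp
  have nn: "0 \<le> P ^ Suc m - 1" using low ge by linarith
  have pow: "P ^ k = exp (ln P * real k)" for k
    using assms by (simp add: exp_of_nat2_mult)
  {
    case 1
    have "exp (ln P * (real (Suc m) * (real (Suc m) - 1) / 2)) = exp (ln P * (real m * (real m - 1) / 2)) * P ^ m"
      unfolding pow exp_add [symmetric] by (simp add: field_simps)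
    also have "\<dots> \<le> qfact P m * (P ^ Suc m - 1)"
      using Suc low nn ge qfact_pos [of P m] assms by (intro mult_mono) (auto simp del: power_Suc)
    finally show ?case by (simp add: qfact_Suc)
  next
    case 2
    have "qfact P m * (P ^ Suc m - 1) \<le> exp (ln P * (real m * (real m + 1) / 2)) * P ^ Suc m"
      using Suc low nn ge qfact_pos [of P m] assms by (intro mult_mono) (auto simp del: power_Suc)
    also have "\<dots> = exp (ln P * (real (Suc m) * (real (Suc m) + 1) / 2))"
      unfolding pow exp_add [symmetric] by (simp add: field_simps)
    finally show ?case by (simp add: qfact_Suc)
  }
qed auto

lemma real_sum_Icc_nat: "real (\<Sum>{1..m}) = real m * (real m + 1) / 2"
  by (induction m) (auto simp: field_simps)

context approximants
begin

text \<open>The power of p with real exponent, so that size estimates become inequalities between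
  polynomials, including those with half-integral coefficients.\<close>

definition E :: "real \<Rightarrow> real" where
  "E x = exp (ln (real p) * x)"

lemma E_pos [simp]: "E x > 0" "E x \<ge> 0" "E x \<noteq> 0"
  by (auto simp: E_def)

lemma E_add: "E (x + y) = E x * E y"
  by (simp add: E_def distrib_left exp_add)

lemma E_diff: "E (x - y) = E x / E y"
  by (simp add: E_def right_diff_distrib exp_diff)

lemma E_mono: "x \<le> y \<Longrightarrow> E x \<le> E y"
  using p2 by (simp add: E_def)

lemma E_power: "real p ^ k = E (real k)"
  using p2 by (simp add: E_def exp_of_nat2_mult)

lemma E_sum: "finite A \<Longrightarrow> (\<Prod>i\<in>A. E (f i)) = E (\<Sum>i\<in>A. f i)"
  by (simp add: E_def exp_sum sum_distrib_left)

lemma E_square: "(E x)\<^sup>2 = E (2 * x)"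
  by (simp add: power2_eq_square flip: E_add)

lemma qfact_E:
  "E (real m * (real m - 1) / 2) \<le> qfact (real p) m"
  "qfact (real p) m \<le> E (real m * (real m + 1) / 2)"
  using qfact_bounds [of "real p" m] p2 by (auto simp: E_def)

lemma power_minus_one_E:
  assumes "k \<ge> 1"
  shows "E (real k - 1) \<le> real p ^ k - 1" "real p ^ k - 1 \<le> E (real k)"
proof -
  obtain m where m: "k = Suc m" using assms by (cases k) auto
  have "1 \<le> real p ^ m" using p2 by (intro one_le_power) auto
  moreover have "2 * real p ^ m \<le> real p * real p ^ m" using p2 by (intro mult_right_mono) auto
  ultimately have "real p ^ m \<le> real p ^ Suc m - 1" by simp
  then show "E (real k - 1) \<le> real p ^ k - 1" unfolding E_power by (simp add: m)
  show "real p ^ k - 1 \<le> E (real k)" unfolding E_power by simp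
qed

lemma core_pos: "core j > 0"
  unfolding core_def by (intro divide_pos_pos mult_pos_pos zero_less_power qfact_pos [OF P])

lemma core_le:
  assumes j: "N \<le> j" "j \<le> 16 * N"
  shows "core j \<le> E (15 * real N * (15 * real N + 1) / 2 + (16 * real N + real j) * (16 * real N + real j + 1) / 2
    - ((real j - real N) * (real j - real N - 1) / 2 + (16 * real N - real j) * (16 * real N - real j - 1) + real j * (real j - 1)))"
proof -
  have "core j \<le> E (15 * real N * (15 * real N + 1) / 2) * E ((16 * real N + real j) * (16 * real N + real j + 1) / 2) /
      (E ((real j - real N) * (real j - real N - 1) / 2) * (E ((16 * real N - real j) * (16 * real N - real j - 1) / 2))\<^sup>2
        * (E (real j * (real j - 1) / 2))\<^sup>2)"
    unfolding core_def
    using qfact_E [of "16 * N - N"] qfact_E [of "16 * N + j"] qfact_E [of "j - N"] qfact_E [of "16 * N - j"] qfact_E [of j] j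
    by (intro frac_le mult_mono power_mono mult_nonneg_nonneg mult_pos_pos) (auto simp: of_nat_diff less_imp_le [OF qfact_pos [OF P]])
  also have "\<dots> = E (15 * real N * (15 * real N + 1) / 2 + (16 * real N + real j) * (16 * real N + real j + 1) / 2
    - ((real j - real N) * (real j - real N - 1) / 2 + (16 * real N - real j) * (16 * real N - real j - 1) + real j * (real j - 1)))"
    unfolding E_square E_add [symmetric] E_diff [symmetric] by (simp add: mult.commute)
  finally show ?thesis .
qed

text \<open>The quadratic part of the exponent is (481/2) N^2 - (16 N - j)^2, so the weights at j
  near 16 N dominate; the linear part is at most 47 N.\<close>

lemma weight_le:
  assumes j: "N \<le> j" "j \<le> 16 * N"
  shows "\<bar>qfact (real p) (15 * N) * (wt1 j * wt2 j / real p ^ j)\<bar> \<le> E (481 / 2 * (real N)\<^sup>2 + 47 * real N)"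
proof -
  have "qfact (real p) (15 * N) * (wt1 j * wt2 j / real p ^ j) =
      (-1) ^ (16 * N + N) * real p ^ (\<Sum>{1..j - N} + \<Sum>{1..j}) / real p ^ (16 * N * j + j) * core j"
    using wt_product_core [OF j] by simp
  then have "\<bar>qfact (real p) (15 * N) * (wt1 j * wt2 j / real p ^ j)\<bar> =
      real p ^ (\<Sum>{1..j - N} + \<Sum>{1..j}) / real p ^ (16 * N * j + j) * core j"
    using core_pos [of j] by (simp add: abs_mult power_abs)
  also have "real p ^ (\<Sum>{1..j - N} + \<Sum>{1..j}) / real p ^ (16 * N * j + j) =
      E ((real j - real N) * (real j - real N + 1) / 2 + real j * (real j + 1) / 2 - (16 * real N * real j + real j))"
    unfolding E_power of_nat_add real_sum_Icc_nat E_diff [symmetric] using j by (simp add: of_nat_diff)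
  also have "\<dots> * core j \<le> \<dots> * E (15 * real N * (15 * real N + 1) / 2 + (16 * real N + real j) * (16 * real N + real j + 1) / 2
    - ((real j - real N) * (real j - real N - 1) / 2 + (16 * real N - real j) * (16 * real N - real j - 1) + real j * (real j - 1)))"
    using core_le [OF j] by (rule mult_left_mono) simp
  also have "\<dots> \<le> E (481 / 2 * (real N)\<^sup>2 + 47 * real N)"
    unfolding E_add [symmetric]
  proof (rule E_mono)
    have "0 \<le> (16 * real N - real j)\<^sup>2" by simp
    moreover have "real j \<le> 16 * real N" using j by simp
    ultimately show "(real j - real N) * (real j - real N + 1) / 2 + real j * (real j + 1) / 2 - (16 * real N * real j + real j) +
      (15 * real N * (15 * real N + 1) / 2 + (16 * real N + real j) * (16 * real N + real j + 1) / 2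
    - ((real j - real N) * (real j - real N - 1) / 2 + (16 * real N - real j) * (16 * real N - real j - 1) + real j * (real j - 1)))
      \<le> 481 / 2 * (real N)\<^sup>2 + 47 * real N"
      by (simp add: power2_eq_square field_simps)
  qed
  finally show ?thesis .
qed

lemma denom_pos: "denom > 0"
  unfolding denom_def using cyc_prod_pos by simp

lemma coeff_zeta_le:
  "\<bar>coeff_zeta\<bar> \<le> denom * ((15 * real N + 1) * E (625 / 2 * (real N)\<^sup>2 + 48 * real N))"
proof -
  have "\<bar>coeff_zeta\<bar> = real p ^ (72 * N\<^sup>2 + N) * denom * \<bar>\<Sum>j=N..16 * N. qfact (real p) (15 * N) * (wt1 j * wt2 j / real p ^ j)\<bar>"
    using denom_pos unfolding coeff_zeta_def scale_def sum_distrib_left [symmetric] by (simp add: abs_mult)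
  also have "\<dots> \<le> real p ^ (72 * N\<^sup>2 + N) * denom * (\<Sum>j=N..16 * N. E (481 / 2 * (real N)\<^sup>2 + 47 * real N))"
    using denom_pos weight_le by (intro mult_left_mono order_trans [OF sum_abs] sum_mono) auto
  also have "\<dots> = denom * ((15 * real N + 1) * (E (72 * (real N)\<^sup>2 + real N) * E (481 / 2 * (real N)\<^sup>2 + 47 * real N)))"
    unfolding E_power by simp
  also have "E (72 * (real N)\<^sup>2 + real N) * E (481 / 2 * (real N)\<^sup>2 + 47 * real N) = E (625 / 2 * (real N)\<^sup>2 + 48 * real N)"
    unfolding E_add [symmetric] by (simp add: field_simps)
  finally show ?thesis .
qed

lemma summand_eq_0:
  assumes "1 \<le> T" "T \<le> 16 * N"
  shows "summand (real p ^ T) = 0"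
  using assms unfolding summand_def by auto

lemma sum_Icc_real_shift:
  "(\<Sum>i=N..16 * N. c + real i) = (15 * real N + 1) * c + 17 * real N * (15 * real N + 1) / 2"
  "(\<Sum>i=0..16 * N. c + real i) = (16 * real N + 1) * c + 8 * real N * (16 * real N + 1)"
proof -
  have 0: "(\<Sum>i=0..m. real i) = real m * (real m + 1) / 2" for m :: nat
    by (induction m) (auto simp: field_simps)
  have "(\<Sum>i=N..16 * N. real i) = (\<Sum>i=0..16 * N. real i) - (\<Sum>i=0..N - 1. real i)"
    using sum.ub_add_nat [of 0 "N - 1" real "15 * N + 1"] N1 by simp
  also have "\<dots> = 17 * real N * (15 * real N + 1) / 2"
    unfolding 0 using N1 by (simp add: of_nat_diff field_simps)
  finally show "(\<Sum>i=N..16 * N. c + real i) = (15 * real N + 1) * c + 17 * real N * (15 * real N + 1) / 2"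
    unfolding sum.distrib by (simp add: algebra_simps)
  show "(\<Sum>i=0..16 * N. c + real i) = (16 * real N + 1) * c + 8 * real N * (16 * real N + 1)"
    unfolding sum.distrib 0 by (simp add: field_simps)
qed

lemma pole_product_bounds:
  assumes "T \<ge> 1" "finite A"
  shows "E (\<Sum>i\<in>A. (real T - 1) + real i) \<le> (\<Prod>i\<in>A. real p ^ T * real p ^ i - 1)"
    and "(\<Prod>i\<in>A. real p ^ T * real p ^ i - 1) \<le> E (\<Sum>i\<in>A. real T + real i)"
proof -
  have 1: "E ((real T - 1) + real i) \<le> real p ^ T * real p ^ i - 1" for i
    using power_minus_one_E(1) [of "T + i"] assms by (simp add: power_add algebra_simps)
  have 2: "real p ^ T * real p ^ i - 1 \<le> E (real T + real i)" for i
    using power_minus_one_E(2) [of "T + i"] assms by (simp add: power_add)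
  show "E (\<Sum>i\<in>A. (real T - 1) + real i) \<le> (\<Prod>i\<in>A. real p ^ T * real p ^ i - 1)"
    unfolding E_sum [OF assms(2), symmetric] by (intro prod_mono) (use 1 in auto)
  show "(\<Prod>i\<in>A. real p ^ T * real p ^ i - 1) \<le> E (\<Sum>i\<in>A. real T + real i)"
    unfolding E_sum [OF assms(2), symmetric]
    by (intro prod_mono) (use 2 order_trans [OF less_imp_le [OF E_pos(1)] 1] in auto)
qed

lemma summand_upper:
  assumes T: "T > 16 * N"
  shows "0 \<le> summand (real p ^ T)"
    and "summand (real p ^ T) \<le> E (- (15 * real N + 1) * real T + 29 / 2 * real N + 2 - 511 / 2 * (real N)\<^sup>2)"
proof -
  have fac: "0 \<le> real p ^ T - real p ^ s" "real p ^ T - real p ^ s \<le> E (real T)" if "s \<in> {1..16 * N}" for s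
    using that T p2 by (auto simp: power_increasing simp flip: E_power)
  have prod_nn: "0 \<le> (\<Prod>s=1..16 * N. real p ^ T - real p ^ s)"
    using fac by (intro prod_nonneg) auto
  have num: "(\<Prod>s=1..16 * N. real p ^ T - real p ^ s) \<le> E (16 * real N * real T)"
  proof -
    have "(\<Prod>s=1..16 * N. real p ^ T - real p ^ s) \<le> (\<Prod>s=1..16 * N. E (real T))"
      using fac by (intro prod_mono) auto
    also have "\<dots> = E (16 * real N * real T)" unfolding E_sum [OF finite_atLeastAtMost] by simp
    finally show ?thesis .
  qed
  have T1: "T \<ge> 1" using T by simp
  have den: "E (\<Sum>i=N..16 * N. (real T - 1) + real i) \<le> (\<Prod>i=N..16 * N. real p ^ T * real p ^ i - 1)"
    "E (\<Sum>i=0..16 * N. (real T - 1) + real i) \<le> (\<Prod>i=0..16 * N. real p ^ T * real p ^ i - 1)"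
    using pole_product_bounds(1) [OF T1 finite_atLeastAtMost] by blast+
  have den_pos: "0 < (\<Prod>i=N..16 * N. real p ^ T * real p ^ i - 1)" "0 < (\<Prod>i=0..16 * N. real p ^ T * real p ^ i - 1)"
    using den E_pos(1) less_le_trans by blast+
  show "0 \<le> summand (real p ^ T)"
    unfolding summand_def using prod_nn den_pos by (intro divide_nonneg_nonneg mult_nonneg_nonneg) auto
  have "summand (real p ^ T) \<le> (E (real T) * E (16 * real N * real T)) /
      (E (\<Sum>i=N..16 * N. (real T - 1) + real i) * E (\<Sum>i=0..16 * N. (real T - 1) + real i))"
    unfolding summand_def using num den prod_nn den_pos
    by (intro frac_le mult_mono) (auto simp flip: E_power)
  also have "\<dots> = E (- (15 * real N + 1) * real T + 29 / 2 * real N + 2 - 511 / 2 * (real N)\<^sup>2)"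
    unfolding E_add [symmetric] E_diff [symmetric] sum_Icc_real_shift
    by (rule arg_cong [where f = E]) (simp add: field_simps power2_eq_square)
  finally show "summand (real p ^ T) \<le> E (- (15 * real N + 1) * real T + 29 / 2 * real N + 2 - 511 / 2 * (real N)\<^sup>2)" .
qed

lemma summand_lower:
  "E (- 991 / 2 * (real N)\<^sup>2 - 127 / 2 * real N - 1) \<le> summand (real p ^ Suc (16 * N))"
proof -
  define T where "T = Suc (16 * N)"
  have T1: "T \<ge> 1" by (simp add: T_def)
  have rT: "real T = 16 * real N + 1" by (simp add: T_def)
  have fac: "E (16 * real N) \<le> real p ^ T - real p ^ s" if "s \<in> {1..16 * N}" for s
  proof -
    have "real p ^ s \<le> real p ^ (16 * N)" using that p2 by (intro power_increasing) auto
    moreover have "2 * real p ^ (16 * N) \<le> real p ^ T" using p2 by (simp add: T_def)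
    ultimately show ?thesis using E_power [of "16 * N"] by simp
  qed
  have "(\<Prod>s=1..16 * N. E (16 * real N)) \<le> (\<Prod>s=1..16 * N. real p ^ T - real p ^ s)"
    using fac by (intro prod_mono) auto
  then have num: "E (256 * (real N)\<^sup>2) \<le> (\<Prod>s=1..16 * N. real p ^ T - real p ^ s)"
    unfolding E_sum [OF finite_atLeastAtMost] by (simp add: power2_eq_square)
  have den: "(\<Prod>i=N..16 * N. real p ^ T * real p ^ i - 1) \<le> E (\<Sum>i=N..16 * N. real T + real i)"
    "(\<Prod>i=0..16 * N. real p ^ T * real p ^ i - 1) \<le> E (\<Sum>i=0..16 * N. real T + real i)"
    using pole_product_bounds(2) [OF T1 finite_atLeastAtMost] by blast+
  have den_pos: "0 < (\<Prod>i=N..16 * N. real p ^ T * real p ^ i - 1)" "0 < (\<Prod>i=0..16 * N. real p ^ T * real p ^ i - 1)"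
    using pole_product_bounds(1) [OF T1 finite_atLeastAtMost] E_pos(1) less_le_trans by blast+
  have "E (- 991 / 2 * (real N)\<^sup>2 - 127 / 2 * real N - 1) = (E (real T) * E (256 * (real N)\<^sup>2)) /
      (E (\<Sum>i=N..16 * N. real T + real i) * E (\<Sum>i=0..16 * N. real T + real i))"
    unfolding E_add [symmetric] E_diff [symmetric] sum_Icc_real_shift rT
    by (rule arg_cong [where f = E]) (simp add: field_simps power2_eq_square)
  also have "\<dots> \<le> summand (real p ^ T)"
    unfolding summand_def using num den den_pos less_le_trans [OF E_pos(1) num, THEN less_imp_le]
    by (intro frac_le mult_mono mult_pos_pos mult_nonneg_nonneg) (auto simp flip: E_power)
  finally show ?thesis by (simp add: T_def)
qed

definition remainder :: real where
  "remainder = coeff_zeta * zeta_q2 (1 / real p) - coeff_const"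

lemma scale_pos: "scale > 0"
  unfolding scale_def using denom_pos qfact_pos [OF P] p2 by simp

lemma remainder_sums: "(\<lambda>u. scale * summand (real p ^ Suc (u + 16 * N))) sums remainder"
proof -
  have "(\<lambda>t. scale * summand (real p ^ Suc t)) sums remainder"
    unfolding remainder_def by (rule summand_sums_linear_form)
  then have "(\<lambda>u. scale * summand (real p ^ Suc (u + 16 * N))) sums
      (remainder - (\<Sum>t<16 * N. scale * summand (real p ^ Suc t)))"
    by (rule sums_split_initial_segment)
  moreover have "(\<Sum>t<16 * N. scale * summand (real p ^ Suc t)) = 0"
    by (intro sum.neutral) (auto simp: summand_eq_0 simp del: power_Suc)
  ultimately show ?thesis by simp
qed

text \<open>All terms are nonnegative, so the first nonzero one, at x = p ^ (16 N + 1), suffices.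
  The rate 311 is 991/2 from the summand minus 225/2 from \<open>qfact\<close> and 72 from the power
  of p in \<open>scale\<close>.\<close>

lemma remainder_lower: "denom * E (- 311 * (real N)\<^sup>2 - 70 * real N - 1) \<le> remainder"
proof -
  have "denom * E (- 311 * (real N)\<^sup>2 - 70 * real N - 1) =
      real p ^ (72 * N\<^sup>2 + N) * denom * E (15 * real N * (15 * real N - 1) / 2) * E (- 991 / 2 * (real N)\<^sup>2 - 127 / 2 * real N - 1)"
  proof -
    have "E (- 311 * (real N)\<^sup>2 - 70 * real N - 1) = E (72 * (real N)\<^sup>2 + real N) * E (15 * real N * (15 * real N - 1) / 2)
        * E (- 991 / 2 * (real N)\<^sup>2 - 127 / 2 * real N - 1)"
      unfolding E_add [symmetric] by (rule arg_cong [where f = E]) (simp add: field_simps power2_eq_square)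
    then show ?thesis unfolding E_power by simp
  qed
  also have "\<dots> \<le> scale * summand (real p ^ Suc (0 + 16 * N))"
    unfolding scale_def using qfact_E(1) [of "15 * N"] summand_lower denom_pos qfact_pos [OF P, of "15 * N"]
    by (intro mult_mono mult_nonneg_nonneg) auto
  also have "\<dots> = (\<Sum>u\<in>{0}. scale * summand (real p ^ Suc (u + 16 * N)))" by simp
  also have "\<dots> \<le> (\<Sum>u. scale * summand (real p ^ Suc (u + 16 * N)))"
  proof (rule sum_le_suminf)
    show "summable (\<lambda>u. scale * summand (real p ^ Suc (u + 16 * N)))" using remainder_sums by (simp add: sums_iff)
    show "0 \<le> scale * summand (real p ^ Suc (u + 16 * N))" for u
      using scale_pos summand_upper(1) [of "Suc (u + 16 * N)"] by simp
  qed simp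
  also have "\<dots> = remainder" using remainder_sums by (simp add: sums_iff)
  finally show ?thesis .
qed

text \<open>Each further term gains a factor p ^ - (15 N + 1) in the bound; a factor 1/2 already
  makes the tail geometric. No linear term in N is left, as its coefficient is negative.\<close>

lemma remainder_upper: "remainder \<le> 2 * (denom * E (- 311 * (real N)\<^sup>2 + 1))"
proof -
  define M where "M = denom * E (- 311 * (real N)\<^sup>2 + 1)"
  have "(\<lambda>u. M * (1 / 2) ^ u) sums (M * (1 / (1 - 1 / 2)))"
    by (intro sums_mult geometric_sums) auto
  then have geo: "(\<lambda>u. M * (1 / 2) ^ u) sums (2 * M)" by (simp add: mult.commute)
  have "scale * summand (real p ^ Suc (u + 16 * N)) \<le> M * (1 / 2) ^ u" for u
  proof -
    define T where "T = Suc (u + 16 * N)"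
    have rT: "real T = real u + 16 * real N + 1" by (simp add: T_def)
    have half: "E (- real u) \<le> (1 / 2) ^ u"
    proof -
      have "E (- real u) = (1 / real p) ^ u"
        using E_diff [of 0 "real u"] by (simp add: E_power power_one_over) (simp add: E_def)
      also have "\<dots> \<le> (1 / 2) ^ u" using p2 by (intro power_mono divide_left_mono) auto
      finally show ?thesis .
    qed
    have "scale * summand (real p ^ T) \<le> real p ^ (72 * N\<^sup>2 + N) * denom * E (15 * real N * (15 * real N + 1) / 2)
        * E (- (15 * real N + 1) * real T + 29 / 2 * real N + 2 - 511 / 2 * (real N)\<^sup>2)"
      unfolding scale_def using qfact_E(2) [of "15 * N"] summand_upper [of T] denom_pos qfact_pos [OF P, of "15 * N", THEN less_imp_le]
      by (intro mult_mono mult_nonneg_nonneg) (auto simp: T_def)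
    also have "\<dots> = denom * E (72 * (real N)\<^sup>2 + real N + 15 * real N * (15 * real N + 1) / 2
        + (- (15 * real N + 1) * real T + 29 / 2 * real N + 2 - 511 / 2 * (real N)\<^sup>2))"
    proof -
      have "real p ^ (72 * N\<^sup>2 + N) = E (72 * (real N)\<^sup>2 + real N)" unfolding E_power by simp
      then show ?thesis unfolding E_add by (simp only: mult_ac)
    qed
    also have "\<dots> \<le> denom * E (- 311 * (real N)\<^sup>2 + 1 + - real u)"
      using denom_pos unfolding rT
      by (intro mult_left_mono E_mono) (auto simp: field_simps power2_eq_square)
    also have "\<dots> = M * E (- real u)" unfolding E_add M_def by simp
    also have "\<dots> \<le> M * (1 / 2) ^ u"
      using half denom_pos by (intro mult_left_mono) (auto simp: M_def)
    finally show ?thesis by (simp add: T_def)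
  qed
  then have "remainder \<le> 2 * M"
    using sums_le [OF _ remainder_sums geo] by blast
  then show ?thesis by (simp add: M_def)
qed

end

section \<open>Size of the denominators and conclusion\<close>

text \<open>No k is counted for two values of m: consecutive multiples of a saved k differ by more
  than 2 N, while the window from 16 N to 17 N has length N.\<close>

lemma sum_saved_intervals:
  fixes f :: "nat \<Rightarrow> real"
  shows "(\<Sum>k | saved N k. f k) = (\<Sum>m=2..8. \<Sum>k\<in>{16 * N div m<..17 * N div m}. f k)"
proof -
  have iff: "k \<in> {16 * N div m<..17 * N div m} \<longleftrightarrow> 16 * N < m * k \<and> m * k \<le> 17 * N" if "m \<in> {2..8}" for m k
    using that by (auto simp: div_less_iff_less_mult less_eq_div_iff_mult_less_eq mult.commute)
  have eq: "{k. saved N k} = (\<Union>m\<in>{2..8}. {16 * N div m<..17 * N div m})"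
    using iff unfolding saved_def by blast
  have disj: False
    if m: "m \<in> {2..8}" "m' \<in> {2..8}" "m < m'"
      and k: "k \<in> {16 * N div m<..17 * N div m}" "k \<in> {16 * N div m'<..17 * N div m'}" for m m' k
  proof -
    have "saved N k" using m k eq by blast
    then have "2 * N < k" by (rule saved_gt)
    have "16 * N < m * k" "m' * k \<le> 17 * N" using iff m k by blast+
    moreover have "Suc m * k \<le> m' * k" using m by (intro mult_le_mono1) auto
    ultimately show False using \<open>2 * N < k\<close> by simp
  qed
  show ?thesis unfolding eq
  proof (rule sum.UNION_disjoint)
    show "\<forall>i\<in>{2..8}. \<forall>j\<in>{2..8}. i \<noteq> j \<longrightarrow>
        {16 * N div i<..17 * N div i} \<inter> {16 * N div j<..17 * N div j} = {}"
      using disj by (metis disjoint_iff linorder_neqE_nat)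
  qed auto
qed

lemma ln_cyc_prod_exp:
  assumes "p \<ge> 2"
  shows "ln (real (cyc_prod p (32 * N) (cyc_exp N))) =
    2 * cyc_psi p (16 * N) - (\<Sum>m=2..8. cyc_psi p (17 * N div m) - cyc_psi p (16 * N div m))"
proof -
  define f where "f k = ln (real (cyc p k))" for k
  have saved_sub: "{k. saved N k} \<subseteq> {1..16 * N}"
  proof
    fix k assume "k \<in> {k. saved N k}"
    then obtain m where m: "2 \<le> m" "16 * N < m * k" "m * k \<le> 17 * N" by (auto simp: saved_def)
    have "2 * k \<le> m * k" using m by (intro mult_le_mono1)
    moreover have "k \<noteq> 0" using m by (intro notI) simp
    ultimately have "1 \<le> k" "k \<le> 16 * N" using m by linarith+
    then show "k \<in> {1..16 * N}" by simp
  qed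
  have "ln (real (cyc_prod p (32 * N) (cyc_exp N))) = (\<Sum>k=1..32 * N. real (cyc_exp N k) * f k)"
    unfolding cyc_prod_def of_nat_prod of_nat_power f_def
    by (subst ln_prod) (auto simp: cyc_pos ln_realpow)
  also have "\<dots> = (\<Sum>k=1..16 * N. real (cyc_exp N k) * f k)"
    by (intro sum.mono_neutral_right) (auto simp: cyc_exp_def)
  also have "\<dots> = (\<Sum>k=1..16 * N. 2 * f k - (if saved N k then f k else 0))"
    by (intro sum.cong refl) (auto simp: cyc_exp_def)
  also have "\<dots> = 2 * cyc_psi p (16 * N) - (\<Sum>k=1..16 * N. if saved N k then f k else 0)"
    by (simp add: sum_subtractf sum_distrib_left cyc_psi_def f_def)
  also have "(\<Sum>k=1..16 * N. if saved N k then f k else 0) = (\<Sum>k | saved N k. f k)"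
  proof -
    have "{k. saved N k} = {k \<in> {1..16 * N}. saved N k}" using saved_sub by auto
    then show ?thesis by (simp only: sum.inter_filter [symmetric] finite_atLeastAtMost)
  qed
  also have "\<dots> = (\<Sum>m=2..8. cyc_psi p (17 * N div m) - cyc_psi p (16 * N div m))"
    unfolding sum_saved_intervals
  proof (intro sum.cong refl)
    fix m :: nat
    have le: "16 * N div m \<le> 17 * N div m" by (intro div_le_mono) auto
    have "{1..17 * N div m} = {1..16 * N div m} \<union> {16 * N div m<..17 * N div m}" using le by auto
    then have "cyc_psi p (17 * N div m) = cyc_psi p (16 * N div m) + (\<Sum>k\<in>{16 * N div m<..17 * N div m}. f k)"
      unfolding cyc_psi_def f_def by (simp only:) (rule sum.union_disjoint, auto)
    then show "(\<Sum>k\<in>{16 * N div m<..17 * N div m}. f k) = cyc_psi p (17 * N div m) - cyc_psi p (16 * N div m)"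
      by simp
  qed
  finally show ?thesis .
qed

text \<open>By the quadratic growth of \<open>cyc_psi\<close>, the saved k with multiplier m
  contribute (17^2 - 16^2) / m^2 = 33 / m^2 in units of (3 * ln p / pi^2) * N^2.\<close>

definition saving :: real where
  "saving = (\<Sum>m=2..8. 1 / (real m)\<^sup>2)"

lemma saving_gt: "saving > 527 / 1000" "saving < 53 / 100"
  unfolding saving_def by (simp_all add: eval_nat_numeral sum.atLeast_Suc_atMost)

text \<open>The limiting upper rate: \<open>denom\<close> is at most p ^ ((\<open>denom_rate\<close>
  + o(1)) * N^2). The two summands are 2 * 16^2 and 33 * \<open>saving\<close>, each times 3 /
  pi^2.\<close>

definition denom_rate :: real where
  "denom_rate = (256 - 33 / 2 * saving) * (6 / pi\<^sup>2)"

lemma ln_cyc_prod_exp_le: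
  fixes \<epsilon> :: real
  assumes "p \<ge> 2" "\<epsilon> > 0"
  shows "\<exists>K. \<forall>N. ln (real (cyc_prod p (32 * N) (cyc_exp N))) \<le> (ln (real p) * denom_rate + \<epsilon>) * (real N)\<^sup>2 + K"
proof -
  define c where "c = 3 * ln (real p) / pi\<^sup>2"
  have "c > 0" using assms by (simp add: c_def)
  \<comment> \<open>The errors add up to 2 * 16^2 + 7 * (16^2 + 17^2) = 4327 times \<delta> * N^2,
    which must stay below (3/4) \<epsilon> * N^2.\<close>
  define \<delta> where "\<delta> = \<epsilon> / 10000"
  have "\<delta> > 0" using assms by (simp add: \<delta>_def)
  obtain K where K: "\<And>n. \<bar>cyc_psi p n - c * (real n)\<^sup>2\<bar> \<le> \<delta> * (real n)\<^sup>2 + K"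
    using cyc_psi_asymp [OF assms(1) \<open>\<delta> > 0\<close>] unfolding c_def by blast
  define K' where "K' = (7 * c * 34)\<^sup>2 / (\<epsilon> / 4)"
  have K': "7 * c * (34 * real N) \<le> \<epsilon> / 4 * (real N)\<^sup>2 + K'" for N
    using linear_le_quadratic [of "\<epsilon> / 4" "7 * c * 34" "real N"] \<open>\<epsilon> > 0\<close> by (simp add: K'_def mult.assoc)
  have "ln (real (cyc_prod p (32 * N) (cyc_exp N))) \<le> (ln (real p) * denom_rate + \<epsilon>) * (real N)\<^sup>2 + (16 * K + 7 * c + K')" for N
  proof -
    have each: "cyc_psi p (16 * N div m) - cyc_psi p (17 * N div m) \<le>
        - 33 * c * (1 / (real m)\<^sup>2) * (real N)\<^sup>2 + c * (34 * real N + 1) + 545 * \<delta> * (real N)\<^sup>2 + 2 * K"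
      if "m \<in> {2..8}" for m
    proof -
      have m1: "real m \<ge> 1" using that by auto
      define x where "x = real N / real m"
      have x: "0 \<le> x" "x \<le> real N" using m1 by (auto simp: x_def divide_le_eq mult_right_le_one_le mult_le_cancel_left1)
      have up: "real (16 * N div m) \<le> 16 * x"
        using of_nat_div_le_of_nat [of "16 * N" m, where 'a = real] by (simp add: x_def)
      have "real (17 * N div m) = of_int \<lfloor>17 * x\<rfloor>"
        using floor_divide_of_nat_eq [of "17 * N" m, where 'a = real] by (simp add: x_def)
      then have low: "17 * x - 1 \<le> real (17 * N div m)" "real (17 * N div m) \<le> 17 * x" by linarith+
      have 16: "(real (16 * N div m))\<^sup>2 \<le> (16 * x)\<^sup>2" using up by (intro power_mono) auto
      have 17: "(real (17 * N div m))\<^sup>2 \<le> (17 * x)\<^sup>2" using low by (intro power_mono) auto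
      have 18: "(17 * x)\<^sup>2 - 34 * x \<le> (real (17 * N div m))\<^sup>2"
      proof (cases "17 * x \<ge> 1")
        case True
        then have "(17 * x - 1)\<^sup>2 \<le> (real (17 * N div m))\<^sup>2" using low by (intro power_mono) auto
        then show ?thesis by (simp add: power2_eq_square algebra_simps)
      next
        case False
        then have "17 * x * (17 * x) \<le> 17 * x * 1" using x by (intro mult_left_mono) auto
        then have "(17 * x)\<^sup>2 - 34 * x \<le> 0" using x by (simp add: power2_eq_square)
        then show ?thesis using zero_le_power2 [of "real (17 * N div m)"] by linarith
      qed
      have xN: "x\<^sup>2 \<le> (real N)\<^sup>2" using x by (intro power_mono) auto
      have "cyc_psi p (16 * N div m) - cyc_psi p (17 * N div m) \<le>
          (c * (real (16 * N div m))\<^sup>2 + (\<delta> * (real (16 * N div m))\<^sup>2 + K))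
          - (c * (real (17 * N div m))\<^sup>2 - (\<delta> * (real (17 * N div m))\<^sup>2 + K))"
        using K [of "16 * N div m"] K [of "17 * N div m"] by linarith
      also have "\<dots> \<le> (c * (16 * x)\<^sup>2 + (\<delta> * (16 * x)\<^sup>2 + K))
          - (c * ((17 * x)\<^sup>2 - 34 * x) - (\<delta> * (17 * x)\<^sup>2 + K))"
        using \<open>c > 0\<close> \<open>\<delta> > 0\<close> 16 17 18 by (intro diff_mono add_mono mult_left_mono order_refl) auto
      also have "\<dots> = - 33 * c * x\<^sup>2 + 34 * c * x + 545 * \<delta> * x\<^sup>2 + 2 * K"
        by (simp add: power2_eq_square algebra_simps)
      also have "\<dots> \<le> - 33 * c * x\<^sup>2 + 34 * c * real N + 545 * \<delta> * (real N)\<^sup>2 + 2 * K"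
        using \<open>c > 0\<close> \<open>\<delta> > 0\<close> x xN by (intro add_mono mult_left_mono order_refl) auto
      also have "\<dots> \<le> - 33 * c * (1 / (real m)\<^sup>2) * (real N)\<^sup>2 + c * (34 * real N + 1) + 545 * \<delta> * (real N)\<^sup>2 + 2 * K"
        using \<open>c > 0\<close> by (simp add: x_def power_divide algebra_simps)
      finally show ?thesis .
    qed
    have "ln (real (cyc_prod p (32 * N) (cyc_exp N))) =
        2 * cyc_psi p (16 * N) + (\<Sum>m=2..8. cyc_psi p (16 * N div m) - cyc_psi p (17 * N div m))"
      unfolding ln_cyc_prod_exp [OF assms(1)] by (simp add: sum_subtractf)
    also have "\<dots> \<le> 2 * (c * (real (16 * N))\<^sup>2 + (\<delta> * (real (16 * N))\<^sup>2 + K)) +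
        (\<Sum>m=2..8. - 33 * c * (1 / (real m)\<^sup>2) * (real N)\<^sup>2 + c * (34 * real N + 1) + 545 * \<delta> * (real N)\<^sup>2 + 2 * K)"
      using K [of "16 * N"] each by (intro add_mono mult_left_mono sum_mono) auto
    also have "(\<Sum>m=2..8. - 33 * c * (1 / (real m)\<^sup>2) * (real N)\<^sup>2 + c * (34 * real N + 1) + 545 * \<delta> * (real N)\<^sup>2 + 2 * K)
        = - 33 * c * saving * (real N)\<^sup>2 + 7 * (c * (34 * real N + 1) + 545 * \<delta> * (real N)\<^sup>2 + 2 * K)"
      by (simp add: saving_def sum.distrib sum_subtractf sum_distrib_left sum_distrib_right sum_negf mult.assoc)
    also have "2 * (c * (real (16 * N))\<^sup>2 + (\<delta> * (real (16 * N))\<^sup>2 + K)) + \<dots>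
        = (2 * c * (256 - 33 / 2 * saving)) * (real N)\<^sup>2 + 4327 * \<delta> * (real N)\<^sup>2 + 7 * c * (34 * real N) + (16 * K + 7 * c)"
      by (simp add: power_mult_distrib algebra_simps)
    also have "2 * c * (256 - 33 / 2 * saving) = ln (real p) * denom_rate"
      by (simp add: c_def denom_rate_def)
    also have "ln (real p) * denom_rate * (real N)\<^sup>2 + 4327 * \<delta> * (real N)\<^sup>2 + 7 * c * (34 * real N) + (16 * K + 7 * c)
        \<le> (ln (real p) * denom_rate + \<epsilon>) * (real N)\<^sup>2 + (16 * K + 7 * c + K')"
    proof -
      have "4327 * \<delta> * (real N)\<^sup>2 \<le> 3 / 4 * \<epsilon> * (real N)\<^sup>2"
        using assms by (intro mult_right_mono) (auto simp: \<delta>_def)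
      moreover have "(0::real) \<le> \<epsilon> * (real N)\<^sup>2" using assms by simp
      ultimately show ?thesis using K' [of N] by (simp add: algebra_simps)
    qed
    finally show ?thesis .
  qed
  then show ?thesis by blast
qed

text \<open>With s = 6 / pi^2, \<rho> - 1 = (5/4 + s) / (5/4 - s). Clearing denominators turns the
  claim into (165/4 * \<open>saving\<close> - 33/2) * s > 15/8, and the left side is at least 5 *
  6/10 = 3.\<close>

lemma rate_inequality:
  "(625 / 2 + denom_rate) < (10 * pi\<^sup>2 / (5 * pi\<^sup>2 - 24) - 1) * (311 - denom_rate)"
  "denom_rate < 311" "denom_rate > 0"
proof -
  define s where "s = 6 / pi\<^sup>2"
  have s: "6 / 10 < s" "s < 2 / 3"
    using pi_square_bounds by (auto simp: s_def field_simps)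
  have rate: "denom_rate = (256 - 33 / 2 * saving) * s" by (simp add: denom_rate_def s_def)
  have rho: "10 * pi\<^sup>2 / (5 * pi\<^sup>2 - 24) - 1 = (5 / 4 + s) / (5 / 4 - s)"
  proof -
    define y where "y = pi\<^sup>2"
    have y: "y > 9" using pi_square_bounds by (simp add: y_def)
    have "(5 / 4 + s) / (5 / 4 - s) = ((5 / 4 + s) * (4 * y)) / ((5 / 4 - s) * (4 * y))"
      using y by simp
    also have "(5 / 4 + s) * (4 * y) = 5 * y + 24" using y by (simp add: s_def y_def [symmetric] algebra_simps)
    also have "(5 / 4 - s) * (4 * y) = 5 * y - 24" using y by (simp add: s_def y_def [symmetric] algebra_simps)
    also have "(5 * y + 24) / (5 * y - 24) = 10 * y / (5 * y - 24) - 1" using y by (simp add: field_simps)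
    finally show ?thesis by (simp add: y_def)
  qed
  have "(256 - 33 / 2 * saving) * s \<le> 256 * s"
    using s saving_gt by (intro mult_right_mono) auto
  then show lt: "denom_rate < 311" using s rate by linarith
  show "denom_rate > 0" unfolding rate using s saving_gt by (intro mult_pos_pos) auto
  have "(165 / 4 * saving - 33 / 2) * s \<ge> 5 * (6 / 10)"
    using s saving_gt by (intro mult_mono) auto
  moreover have "(625 / 2 + denom_rate) * (5 / 4 - s) - (5 / 4 + s) * (311 - denom_rate) =
      15 / 8 - (165 / 4 * saving - 33 / 2) * s"
    unfolding rate by (simp add: field_simps)
  ultimately have "(625 / 2 + denom_rate) * (5 / 4 - s) < (5 / 4 + s) * (311 - denom_rate)"
    by linarith
  then show "(625 / 2 + denom_rate) < (10 * pi\<^sup>2 / (5 * pi\<^sup>2 - 24) - 1) * (311 - denom_rate)"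
    unfolding rho using s by (simp add: less_divide_eq)
qed

theorem theorem1p1:
  fixes p :: nat and q \<rho> :: real
  assumes "p \<ge> 2"
    and "q = 1 / real p"
    and "\<rho> = 10 * pi\<^sup>2 / (5 * pi\<^sup>2 - 24)"
  shows "zeta_q2 q \<notin> \<rat> \<and>
    finite {(a :: int, b :: int). b \<noteq> 0 \<and>
      \<bar>zeta_q2 q - real_of_int a / real_of_int b\<bar> \<le> \<bar>real_of_int b\<bar> powr (- \<rho>)}"
proof -
  define L where "L = ln (real p)"
  define R where "R = denom_rate"
  have "L > 0" using assms by (simp add: L_def)
  have rate: "625 / 2 + R < (\<rho> - 1) * (311 - R)" "R < 311" "R > 0"
    using rate_inequality assms(3) by (auto simp: R_def)
  have "(\<rho> - 1) * (311 - R) > 0" using rate by linarith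
  then have "\<rho> > 1" using rate by (simp add: zero_less_mult_iff)
  define g where "g = L * ((\<rho> - 1) * (311 - R) - (625 / 2 + R))"
  define w where "w = 3 + 2 * (\<rho> - 1)"
  define \<epsilon> where "\<epsilon> = g / (2 * w)"
  \<comment> \<open>One \<epsilon> in A and one in B pay for the estimate of \<open>denom\<close>,
    another in each for terms of lower order. The third in A makes A + B exceed L * (625/2 + 311) by
    \<epsilon>, as the lower bound for r N / |b N| requires. The total loss \<epsilon> * w is half
    of the gap g.\<close>
  define A where "A = L * (625 / 2 + R) + 3 * \<epsilon>"
  define B where "B = L * (311 - R) - 2 * \<epsilon>"
  have "g > 0" using rate \<open>L > 0\<close> by (simp add: g_def)
  have "w > 0" using \<open>\<rho> > 1\<close> by (simp add: w_def)
  have "\<epsilon> > 0" using \<open>g > 0\<close> \<open>w > 0\<close> by (simp add: \<epsilon>_def)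
  have "\<epsilon> * w = g / 2" using \<open>w > 0\<close> by (simp add: \<epsilon>_def)
  then have "\<epsilon> * w < g" using \<open>g > 0\<close> by simp
  then have AB: "A < (\<rho> - 1) * B" by (simp add: A_def B_def g_def w_def algebra_simps)
  have "A > 0" using \<open>L > 0\<close> \<open>\<epsilon> > 0\<close> rate by (auto simp: A_def intro!: add_pos_pos)
  then have "(\<rho> - 1) * B > 0" using AB by linarith
  then have "B > 0" using \<open>\<rho> > 1\<close> by (simp add: zero_less_mult_iff)
  obtain K where K: "\<And>N. ln (real (cyc_prod p (32 * N) (cyc_exp N))) \<le> (L * R + \<epsilon>) * (real N)\<^sup>2 + K"
    using ln_cyc_prod_exp_le [OF assms(1) \<open>\<epsilon> > 0\<close>] unfolding L_def R_def by blast
  have "eventually (\<lambda>N::nat. N \<ge> 1 \<and>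
      K + ln (15 * real N + 1) + L * (48 * real N) \<le> \<epsilon> * (real N)\<^sup>2 \<and>
      K + ln 2 + L \<le> \<epsilon> * (real N)\<^sup>2 \<and>
      ln (15 * real N + 1) + L * (118 * real N + 1) \<le> \<epsilon> * (real N)\<^sup>2) sequentially"
    using \<open>\<epsilon> > 0\<close> by (intro eventually_conj eventually_ge_at_top; real_asymp)
  then obtain N0 where N0: "\<And>N. N \<ge> N0 \<Longrightarrow> N \<ge> 1 \<and>
      K + ln (15 * real N + 1) + L * (48 * real N) \<le> \<epsilon> * (real N)\<^sup>2 \<and>
      K + ln 2 + L \<le> \<epsilon> * (real N)\<^sup>2 \<and>
      ln (15 * real N + 1) + L * (118 * real N + 1) \<le> \<epsilon> * (real N)\<^sup>2"
    by (auto simp: eventually_sequentially)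
  \<comment> \<open>For N >= 1 the coefficients are integers already; the floor only changes their
    type.\<close>
  define b where "b N = \<lfloor>approximants.coeff_zeta p N\<rfloor>" for N
  define a where "a N = \<lfloor>approximants.coeff_const p N\<rfloor>" for N
  define r where "r N = of_int (b N) * zeta_q2 q - of_int (a N)" for N
  have bounds: "r N > 0 \<and> r N \<le> exp (- B * (real N)\<^sup>2) \<and> \<bar>of_int (b N)\<bar> \<le> exp (A * (real N)\<^sup>2) \<and>
      \<bar>of_int (b N)\<bar> * exp (- (A + B) * (real N)\<^sup>2) \<le> r N" if "N \<ge> N0" for N
  proof -
    from N0 [OF that] have "N \<ge> 1"
      and asym1: "K + ln (15 * real N + 1) + L * (48 * real N) \<le> \<epsilon> * (real N)\<^sup>2"
      and asym2: "K + ln 2 + L \<le> \<epsilon> * (real N)\<^sup>2"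
      and asym3: "ln (15 * real N + 1) + L * (118 * real N + 1) \<le> \<epsilon> * (real N)\<^sup>2"
      by auto
    then interpret approximants p N using assms by unfold_locales auto
    have b_eq: "of_int (b N) = coeff_zeta" using coeff_zeta_Ints by (auto simp: b_def elim: Ints_cases)
    have "of_int (a N) = coeff_const" using coeff_const_Ints by (auto simp: a_def elim: Ints_cases)
    then have r_eq: "r N = remainder" by (simp add: r_def b_eq remainder_def assms(2))
    have E_exp: "E x = exp (L * x)" for x by (simp add: E_def L_def)
    define n2 where "n2 = (real N)\<^sup>2"
    have "0 \<le> \<epsilon> * n2" using \<open>\<epsilon> > 0\<close> by (simp add: n2_def)
    have denom_le: "denom \<le> exp ((L * R + \<epsilon>) * n2 + K)"
      using K [of N] denom_pos unfolding denom_def [symmetric] n2_def [symmetric] by (metis exp_le_cancel_iff exp_ln)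
    have N15: "15 * real N + 1 = exp (ln (15 * real N + 1))" by simp
    have "denom * E (- 311 * n2 - 70 * real N - 1) > 0" using denom_pos by simp
    then have r_pos: "r N > 0" unfolding r_eq using remainder_lower unfolding n2_def by (rule less_le_trans)
    have denom_mono: "denom * x \<le> exp ((L * R + \<epsilon>) * n2 + K) * x" if "x \<ge> 0" for x
      using denom_le that by (rule mult_right_mono)
    have "r N \<le> 2 * (denom * exp (L * (- 311 * n2 + 1)))"
      using remainder_upper by (simp only: r_eq E_exp n2_def)
    also have "\<dots> \<le> exp (ln 2) * (exp ((L * R + \<epsilon>) * n2 + K) * exp (L * (- 311 * n2 + 1)))"
      using denom_mono [of "exp (L * (- 311 * n2 + 1))"] by simp
    also have "\<dots> \<le> exp (- B * n2)"
      unfolding exp_add [symmetric] using asym2 by (simp add: B_def n2_def [symmetric] algebra_simps)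
    finally have r_le: "r N \<le> exp (- B * n2)" .
    have b_denom: "\<bar>of_int (b N)\<bar> \<le> denom * (exp (ln (15 * real N + 1)) * exp (L * (625 / 2 * n2 + 48 * real N)))"
      using coeff_zeta_le by (simp only: b_eq N15 [symmetric] E_exp n2_def)
    also have "\<dots> \<le> exp ((L * R + \<epsilon>) * n2 + K) * (exp (ln (15 * real N + 1)) * exp (L * (625 / 2 * n2 + 48 * real N)))"
      by (rule denom_mono) simp
    also have "\<dots> \<le> exp (A * n2)"
      unfolding exp_add [symmetric] using asym1 \<open>0 \<le> \<epsilon> * n2\<close> by (simp add: A_def n2_def [symmetric] algebra_simps)
    finally have b_le: "\<bar>of_int (b N)\<bar> \<le> exp (A * n2)" .
    have "\<bar>of_int (b N)\<bar> * exp (- (A + B) * n2) \<le>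
        denom * (exp (ln (15 * real N + 1)) * exp (L * (625 / 2 * n2 + 48 * real N))) * exp (- (A + B) * n2)"
      using b_denom by (rule mult_right_mono) simp
    also have "\<dots> = denom * exp (ln (15 * real N + 1) + L * (625 / 2 * n2 + 48 * real N) - (A + B) * n2)"
      by (simp only: diff_conv_add_uminus exp_add mult_minus_left mult.assoc)
    also have "\<dots> \<le> denom * exp (L * (- 311 * n2 - 70 * real N - 1))"
      using denom_pos asym3 by (intro mult_left_mono) (auto simp: A_def B_def n2_def [symmetric] algebra_simps)
    also have "\<dots> \<le> r N" unfolding r_eq using remainder_lower by (simp add: E_exp n2_def)
    finally show ?thesis using r_pos r_le b_le by (simp add: n2_def)
  qed
  have fin: "finite {(a :: int, b :: int). b \<noteq> 0 \<and>
      \<bar>zeta_q2 q - real_of_int a / real_of_int b\<bar> \<le> \<bar>real_of_int b\<bar> powr (- \<rho>)}"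
  proof (rule finite_rational_approximations)
    show "r N = of_int (b N) * zeta_q2 q - of_int (a N)" for N by (rule r_def)
  qed (use bounds \<open>B > 0\<close> \<open>A > 0\<close> AB in blast)+
  then show ?thesis using irrational_if_finite_approximations by blast
qed

end
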